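(* The polytopes $\mathsf P_{1,4}$ and $\mathsf P_{2,3}$ are indecomposable and $4$-dimensional, with $f$-vectors $(15,34,28,9)$ and $(45,111,89,23)$ respectively. Hence both satisfy, with $d=4$, $\mathcal V$ their number of vertices and $\mathcal N$ their number of facets, the inequality $$\mathcal V>1+\binom{\mathcal N-1-\lfloor d/2\rfloor}{\mathcal N-d}+\binom{\mathcal N-1-\lfloor (d+1)/2\rfloor}{\mathcal N-d},$$ although they are indecomposable. In particular, Smilansky's conjecture that every $d$-polytope satisfying this inequality is decomposable is false.
   Context: Let $\mathbb R^{n+m}$ have coordinates and standard basis vectors labeled by $a_1,\dots,a_n,b_1,\dots,b_m$. Let $\mathsf Z_{n,m}=\sum_{i=1}^n\sum_{j=1}^m[e_{a_i},e_{b_j}]\subset\mathbb R^{n+m}$ (Minkowski sum of segments; the graphical zonotope of the complete bipartite graph $K_{n,m}$) and $$\mathsf P_{n,m}=\mathsf Z_{n,m}\cap\Big\{x:\sum_{j=1}^m x_{b_j}\le nm-1\Big\}.$$ A polytope $\mathsf Q$ is a deformation of a polytope $\mathsf P$ if $\lambda\mathsf P=\mathsf Q+\mathsf R$ for some $\lambda>0$ and some polytope $\mathsf R$. A polytope $\mathsf P$ is indecomposable if its only deformations are $\lambda\mathsf P+t$ with $\lambda\ge0$ and $t$ a vector, and decomposable otherwise. The $f$-vector of a $4$-polytope lists its numbers of vertices, edges, $2$-faces and facets. *)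

theory Defs
  imports "HOL-Analysis.Analysis"
begin

text \<open>
  The coordinates \<open>a\<^sub>1, \<dots>, a\<^sub>n\<close> are indexed by \<^term>\<open>Inl i\<close> and \<open>b\<^sub>1, \<dots>, b\<^sub>m\<close> by \<^term>\<open>Inr j\<close>,
  where \<open>n = CARD('n)\<close> and \<open>m = CARD('m)\<close>.  Sums of sets are Minkowski sums.
\<close>

definition bipartite_zonotope :: "(real ^ ('n::finite + 'm::finite)) set" where
  "bipartite_zonotope =
     (\<Sum>i\<in>UNIV. \<Sum>j\<in>UNIV. closed_segment (axis (Inl i) 1) (axis (Inr j) 1))"

definition cut_zonotope :: "(real ^ ('n::finite + 'm::finite)) set" where
  "cut_zonotope =
     bipartite_zonotope \<inter>
     {x. (\<Sum>j\<in>UNIV. x $ Inr j) \<le> real CARD('n) * real CARD('m) - 1}"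

definition P14 :: "(real ^ (1 + 4)) set" where
  "P14 = cut_zonotope"

definition P23 :: "(real ^ (2 + 3)) set" where
  "P23 = cut_zonotope"

definition deformation_of :: "'a::real_vector set \<Rightarrow> 'a set \<Rightarrow> bool" where
  "deformation_of Q P \<longleftrightarrow>
     polytope Q \<and> (\<exists>c>0. \<exists>R. polytope R \<and> (\<lambda>x. c *\<^sub>R x) ` P = Q + R)"

definition indecomposable :: "'a::real_vector set \<Rightarrow> bool" where
  "indecomposable P \<longleftrightarrow>
     polytope P \<and>
     (\<forall>Q. deformation_of Q P \<longrightarrow> (\<exists>c\<ge>0. \<exists>t. Q = (\<lambda>x. c *\<^sub>R x + t) ` P))"

definition decomposable :: "'a::real_vector set \<Rightarrow> bool" where
  "decomposable P \<longleftrightarrow> polytope P \<and> \<not> indecomposable P"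

definition num_vertices :: "'a::euclidean_space set \<Rightarrow> nat" where
  "num_vertices P = card {v. v extreme_point_of P}"

definition num_facets :: "'a::euclidean_space set \<Rightarrow> nat" where
  "num_facets P = card {F. F facet_of P}"

definition f_vector4 :: "'a::euclidean_space set \<Rightarrow> nat \<times> nat \<times> nat \<times> nat" where
  "f_vector4 P =
     (num_vertices P,
      card {e. e edge_of P},
      card {F. F face_of P \<and> aff_dim F = 2},
      num_facets P)"

text \<open>
  A \<open>d\<close>-polytope with \<open>d \<ge> 1\<close> has at least \<open>d + 1\<close> facets, so none of the natural-number
  subtractions below truncates.
\<close>

definition smilansky_inequality :: "nat \<Rightarrow> 'a::euclidean_space set \<Rightarrow> bool" where
  "smilansky_inequality d P \<longleftrightarrow>
     num_vertices P >
       1 + ((num_facets P - 1 - d div 2) choose (num_facets P - d))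
         + ((num_facets P - 1 - (d + 1) div 2) choose (num_facets P - d))"

text \<open>
  HOL cannot quantify over types inside a formula, so the conjecture is stated for the polytopes
  of an arbitrary dimension \<open>d\<close> in a given ambient space; the full conjecture asserts it for
  every ambient space, and is refuted by refuting it for one of them.
\<close>

definition smilansky_conjecture :: "'a::euclidean_space itself \<Rightarrow> bool" where
  "smilansky_conjecture _ \<longleftrightarrow>
     (\<forall>d. \<forall>P :: 'a set. polytope P \<and> aff_dim P = int d \<and> smilansky_inequality d P
        \<longrightarrow> decomposable P)"

end

theory Submission
  imports Defs
begin

text \<open>
  Projecting a cube with one vertex cut off presents each polytope as the hull of integer points, and
  a transport argument gives its facet inequalities.  The incidences between the two determine the
  face lattice: a nonempty face is the set of points at which some of the inequalities are tight,
  edges are the pairs of vertices contained in no larger set of the form ``all vertices on the common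
  facets'', and 2-faces are the intersections of two facets with at least three vertices.

  If \<open>c P = Q + R\<close>, then each vertex \<open>v\<close> of \<open>P\<close> splits as \<open>c v = q v + r v\<close>, the points \<open>q v\<close> span
  \<open>Q\<close>, and along every edge \<open>q u - q v\<close> is a multiple of \<open>u - v\<close>.  The factors of the edges of a triangle
  agree, and so do those of opposite edges of a parallelogram; such steps connect all vertices of
  \<open>P\<close>, hence \<open>q\<close> is a homothety.
\<close>

subsection \<open>Faces of a polytope\<close>

text \<open>A zonotope is far from indecomposable: its edges fall into parallel classes, and each
  class can be scaled on its own. The extra inequality cuts off one vertex of
  \<open>bipartite_zonotope\<close>, the only point whose \<open>b\<close>-coordinates sum to
  \<open>nm\<close>, and its hyperplane passes through all neighbours of that vertex, where the sum
  is \<open>nm - 1\<close>. A complete bipartite graph has no triangles, so the 2-faces of the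
  zonotope are parallelograms; those at the removed vertex become triangles, and each of these ties
  two parallel classes together.

  Two descriptions are carried along because each supplies what the other hides: the hull gives
  boundedness and finitely many candidates for vertices, the inequalities give the faces.\<close>

abbreviation vertices :: "'a::euclidean_space set \<Rightarrow> 'a set" where
  "vertices P \<equiv> {v. v extreme_point_of P}"

lemma face_eq_hull_vertices:
  fixes P :: "'a::euclidean_space set"
  assumes "polytope P" "F face_of P"
  shows "F = convex hull (vertices P \<inter> F)"
proof -
  have "polytope F" using assms face_of_polytope_polytope by blast
  then have "F = convex hull {x. x extreme_point_of F}"
    by (intro Krein_Milman_Minkowski polytope_imp_compact polytope_imp_convex)
  moreover have "{x. x extreme_point_of F} = vertices P \<inter> F"
    using extreme_point_of_face[OF assms(2)] by auto
  ultimately show ?thesis by simp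
qed

lemma face_eqI_vertices:
  fixes P :: "'a::euclidean_space set"
  assumes "polytope P" "F face_of P" "G face_of P" "vertices P \<inter> F = vertices P \<inter> G"
  shows "F = G"
  using face_eq_hull_vertices[OF assms(1,2)] face_eq_hull_vertices[OF assms(1,3)] assms(4) by simp

lemma finite_vertices: "polytope (P :: 'a::euclidean_space set) \<Longrightarrow> finite (vertices P)"
  using finite_polyhedron_extreme_points polytope_imp_polyhedron by blast

lemma vertices_segment_face:
  fixes P :: "'a::euclidean_space set"
  assumes "closed_segment u v face_of P"
  shows "vertices P \<inter> closed_segment u v = {u, v}"
  using extreme_point_of_face[OF assms] extreme_point_of_segment[of _ u v] by auto

lemma face_dim_le_1_imp_segment:
  fixes P :: "'a::euclidean_space set"
  assumes "polytope P" "F face_of P" "F \<noteq> {}" "aff_dim F \<le> 1"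
  obtains u v where "F = closed_segment u v"
proof -
  have "polytope F" using assms face_of_polytope_polytope by blast
  then have "compact F" "convex F" by (auto intro: polytope_imp_compact polytope_imp_convex)
  moreover have "collinear F" using assms(4) by (simp add: collinear_aff_dim)
  ultimately show ?thesis using that compact_convex_collinear_segment assms(3) by metis
qed

text \<open>A face of dimension at most one is a segment, possibly degenerate, and has at most two
  vertices. Dimensions can thus be bounded below by counting vertices, with no rank
  computation.\<close>

lemma face_dim_ge_2_iff:
  fixes P :: "'a::euclidean_space set"
  assumes "polytope P" "F face_of P"
  shows "2 \<le> aff_dim F \<longleftrightarrow> 3 \<le> card (vertices P \<inter> F)"
proof
  assume 2: "2 \<le> aff_dim F"
  have "aff_dim F = aff_dim (vertices P \<inter> F)"
    using face_eq_hull_vertices[OF assms] aff_dim_convex_hull by metis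
  also have "\<dots> \<le> int (card (vertices P \<inter> F)) - 1"
    by (intro aff_dim_le_card finite_Int disjI1 finite_vertices assms)
  finally show "3 \<le> card (vertices P \<inter> F)" using 2 by linarith
next
  assume 3: "3 \<le> card (vertices P \<inter> F)"
  show "2 \<le> aff_dim F"
  proof (rule ccontr)
    assume "\<not> 2 \<le> aff_dim F"
    moreover have "F \<noteq> {}" using 3 by auto
    ultimately obtain u v where F: "F = closed_segment u v"
      using face_dim_le_1_imp_segment[OF assms] by (metis linorder_not_less zle_add1_eq_le one_add_one)
    then have "vertices P \<inter> F = {u, v}" using vertices_segment_face assms(2) by blast
    then have "card (vertices P \<inter> F) \<le> 2" by (simp add: card_insert_if)
    with 3 show False by simp
  qed
qed

lemma edge_iff_segment:
  fixes P :: "'a::euclidean_space set"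
  assumes "polytope P"
  shows "e edge_of P \<longleftrightarrow>
    (\<exists>u v. u \<in> vertices P \<and> v \<in> vertices P \<and> u \<noteq> v \<and> e = closed_segment u v \<and> e face_of P)"
proof
  assume e: "e edge_of P"
  then have f: "e face_of P" "aff_dim e = 1" by (auto simp: edge_of_def)
  then have "e \<noteq> {}" by auto
  then obtain u v where uv: "e = closed_segment u v"
    using face_dim_le_1_imp_segment[OF assms f(1)] f(2) by auto
  moreover have "u \<noteq> v" using uv f(2) by auto
  moreover have "u \<in> vertices P" "v \<in> vertices P"
    using vertices_segment_face[of u v P] f(1) uv by auto
  ultimately show "\<exists>u v. u \<in> vertices P \<and> v \<in> vertices P \<and> u \<noteq> v \<and> e = closed_segment u v \<and> e face_of P"
    using f(1) by blast
next
  assume "\<exists>u v. u \<in> vertices P \<and> v \<in> vertices P \<and> u \<noteq> v \<and> e = closed_segment u v \<and> e face_of P"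
  then obtain u v where "u \<noteq> v" "e = closed_segment u v" "e face_of P" by blast
  moreover have "aff_dim (closed_segment u v) = 1"
    using \<open>u \<noteq> v\<close> by (simp add: segment_convex_hull aff_dim_convex_hull aff_dim_2)
  ultimately show "e edge_of P" by (simp add: edge_of_def)
qed

lemma vertices_not_collinear:
  assumes "x \<in> vertices P" "y \<in> vertices P" "z \<in> vertices P" "x \<noteq> y" "x \<noteq> z" "y \<noteq> z"
  shows "\<not> collinear {x, y, z}"
proof
  assume "collinear {x, y, z}"
  then have "x \<in> closed_segment y z \<or> y \<in> closed_segment z x \<or> z \<in> closed_segment x y"
    by (simp add: collinear_between_cases between_mem_segment)
  with assms show False
    by (auto simp: extreme_point_of_def open_segment_def)
qed

text \<open>No three vertices are collinear, so two differences at a common vertex are linearly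
  independent. This is what allows coefficients to be compared around a triangle or a
  parallelogram.\<close>

lemma vertices_independent:
  fixes x y z :: "'a::euclidean_space"
  assumes "x \<in> vertices P" "y \<in> vertices P" "z \<in> vertices P" "x \<noteq> y" "x \<noteq> z" "y \<noteq> z"
    and "a *\<^sub>R (x - y) = b *\<^sub>R (x - z)"
  shows "a = 0 \<and> b = 0"
proof (rule ccontr)
  assume "\<not> (a = 0 \<and> b = 0)"
  with assms have "a \<noteq> 0" by auto
  have "x - y = (1 / a) *\<^sub>R (a *\<^sub>R (x - y))" using \<open>a \<noteq> 0\<close> by simp
  also have "\<dots> = (b / a) *\<^sub>R (x - z)" by (simp add: assms(7))
  finally have eq: "y = (b / a) *\<^sub>R z + (1 - b / a) *\<^sub>R x"
    by (simp add: algebra_simps)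
  then have "collinear {z, y, x}" unfolding collinear_3_expand by blast
  then have "collinear {x, y, z}" by (simp add: insert_commute)
  then show False using vertices_not_collinear assms by blast
qed

subsection \<open>Polytopes given by inequalities\<close>

text \<open>The polytopes are not full-dimensional, so the equations are kept apart in the affine
  set \<open>A\<close>. The law \<open>s_affine\<close> covers every real \<open>t\<close>, because
  \<open>face_eq_tight\<close> extrapolates beyond an endpoint with a negative parameter.\<close>

locale halfspace_polytope =
  fixes P A :: "'a::euclidean_space set" and H :: "'h set" and s :: "'h \<Rightarrow> 'a \<Rightarrow> real"
  assumes polytope_P: "polytope P" and finite_H: "finite H" and affine_A: "affine A"
    and P_eq: "P = {x \<in> A. \<forall>h\<in>H. 0 \<le> s h x}"
    and s_affine: "\<And>h x y t. s h ((1 - t) *\<^sub>R x + t *\<^sub>R y) = (1 - t) * s h x + t * s h y"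
begin

definition tight :: "'h set \<Rightarrow> 'a set" where
  "tight S = {x \<in> P. \<forall>h\<in>S. s h x = 0}"

lemma tight_empty: "tight {} = P"
  by (simp add: tight_def)

lemma s_nonneg: "x \<in> P \<Longrightarrow> h \<in> H \<Longrightarrow> 0 \<le> s h x"
  by (simp add: P_eq)

lemma tight_face_of:
  assumes "S \<subseteq> H"
  shows "tight S face_of P"
  unfolding face_of_def
proof (intro conjI ballI impI)
  show "tight S \<subseteq> P" by (auto simp: tight_def)
  show "convex (tight S)"
    unfolding convex_alt
  proof (intro ballI allI impI)
    fix x y and t :: real
    assume "x \<in> tight S" "y \<in> tight S" "0 \<le> t \<and> t \<le> 1"
    then show "(1 - t) *\<^sub>R x + t *\<^sub>R y \<in> tight S"
      using polytope_imp_convex[OF polytope_P]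
      by (auto simp: tight_def s_affine convex_alt)
  qed
next
  fix a b x assume *: "a \<in> P" "b \<in> P" "x \<in> tight S" "x \<in> open_segment a b"
  then obtain t where t: "0 < t" "t < 1" "x = (1 - t) *\<^sub>R a + t *\<^sub>R b"
    by (auto simp: in_segment)
  have "s h a = 0 \<and> s h b = 0" if "h \<in> S" for h
  proof -
    have "(1 - t) * s h a + t * s h b = 0"
      using * that t s_affine by (auto simp: tight_def)
    moreover have "0 \<le> s h a" "0 \<le> s h b" using * that assms s_nonneg by auto
    moreover have "0 \<le> (1 - t) * s h a" "0 \<le> t * s h b" using t calculation by auto
    ultimately have "(1 - t) * s h a = 0" "t * s h b = 0" by linarith+
    then show ?thesis using t by simp
  qed
  with * show "a \<in> tight S" "b \<in> tight S" by (auto simp: tight_def)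
qed

text \<open>All slacks are nonnegative on the face, so a positive slack at either endpoint survives
  at the midpoint. Averaging in one point per inequality makes all of them strict at once, as at a
  relative interior point.\<close>

lemma face_slack_point:
  assumes F: "F face_of P" "F \<noteq> {}" and K: "finite K" "K \<subseteq> H" "\<forall>h\<in>K. \<exists>x\<in>F. s h x \<noteq> 0"
  shows "\<exists>c\<in>F. \<forall>h\<in>K. 0 < s h c"
  using K
proof (induction K rule: finite_induct)
  case empty
  then show ?case using F by auto
next
  case (insert h K)
  then obtain c d where c: "c \<in> F" "\<forall>k\<in>K. 0 < s k c" and d: "d \<in> F" "s h d \<noteq> 0" by auto
  define m where "m = (1 - 1/2) *\<^sub>R c + (1/2) *\<^sub>R d"
  have FP: "F \<subseteq> P" using F by (simp add: face_of_imp_subset)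
  have "m \<in> F"
    unfolding m_def using c(1) d(1) by (intro convexD_alt face_of_imp_convex[OF F(1)]) auto
  moreover have "0 < s k m" if "k \<in> insert h K" for k
  proof -
    have "0 \<le> s k c" "0 \<le> s k d" using that insert.prems c(1) d(1) FP s_nonneg by auto
    moreover have "0 < s k c \<or> 0 < s k d"
      using that c(2) d(2) s_nonneg[of d h] d(1) FP insert.prems by (auto simp: less_le)
    ultimately show ?thesis unfolding m_def s_affine by auto
  qed
  ultimately show ?case by blast
qed

text \<open>A point of the face at which no further inequality is tight can be moved slightly away from
  any point of the tight set without leaving \<open>P\<close>, so the face contains the tight set.\<close>

lemma face_eq_tight:
  assumes F: "F face_of P" "F \<noteq> {}"
  shows "\<exists>S\<subseteq>H. F = tight S"
proof (intro exI conjI)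
  define S where "S = {h \<in> H. \<forall>x\<in>F. s h x = 0}"
  show "S \<subseteq> H" by (auto simp: S_def)
  have FP: "F \<subseteq> P" using F by (simp add: face_of_imp_subset)
  obtain c where c: "c \<in> F" "\<forall>h\<in>H - S. 0 < s h c"
    using face_slack_point[OF F, of "H - S"] finite_H by (auto simp: S_def)
  show "F = tight S"
  proof
    show "F \<subseteq> tight S" using FP by (auto simp: tight_def S_def)
    show "tight S \<subseteq> F"
    proof
      fix y assume y: "y \<in> tight S"
      show "y \<in> F"
      proof (cases "y = c")
        case False
        have "\<exists>e>0. \<forall>h\<in>K. e * s h y \<le> s h c" if "finite K" "K \<subseteq> H - S" for K
          using that
        proof (induction K rule: finite_induct)
          case empty
          show ?case by (intro exI[of _ 1]) auto
        next
          case (insert h K)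
          then obtain e where e: "e > 0" "\<forall>h\<in>K. e * s h y \<le> s h c" by auto
          have h: "0 < s h c" "0 \<le> s h y"
            using insert.prems c(2) y s_nonneg by (auto simp: tight_def)
          \<comment> \<open>The summand 1 keeps the denominator positive when \<open>s h y\<close>
            vanishes.\<close>
          define d where "d = min e (s h c / (1 + s h y))"
          have "d > 0" using e h by (simp add: d_def)
          moreover have "d * s k y \<le> s k c" if "k \<in> K" for k
          proof -
            have "0 \<le> s k y" using that insert.prems y s_nonneg by (auto simp: tight_def)
            then have "d * s k y \<le> e * s k y" by (simp add: d_def mult_right_mono)
            then show ?thesis using e(2) that by fastforce
          qed
          moreover have "d * s h y \<le> s h c"
          proof -
            have "d * s h y \<le> s h c / (1 + s h y) * s h y"
              using h by (intro mult_right_mono) (auto simp: d_def)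
            also have "\<dots> \<le> s h c" using h by (simp add: divide_simps algebra_simps)
            finally show ?thesis .
          qed
          ultimately show ?case by auto
        qed
        from this[of "H - S"] obtain e where e: "e > 0" "\<forall>h\<in>H - S. e * s h y \<le> s h c"
          using finite_H by auto
        \<comment> \<open>\<open>z\<close> lies on the line from \<open>y\<close> through
          \<open>c\<close>, beyond \<open>c\<close>. Its slack is
          \<open>(1 + e) * s h c - e * s h y\<close>, which the choice of \<open>e\<close> bounds
          below by \<open>e * s h c\<close>.\<close>
        define z where "z = (1 - (- e)) *\<^sub>R c + (- e) *\<^sub>R y"
        have "y \<in> P" "c \<in> P" using y c FP by (auto simp: tight_def)
        then have "y \<in> A" "c \<in> A" using P_eq by auto
        then have "z \<in> A" unfolding z_def by (intro mem_affine[OF affine_A]) auto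
        moreover have "0 \<le> s h z" if "h \<in> H" for h
        proof (cases "h \<in> S")
          case True
          then show ?thesis unfolding z_def s_affine using y c(1) by (auto simp: tight_def S_def)
        next
          case False
          then have "0 < s h c" "e * s h y \<le> s h c" using that c e by auto
          moreover have "0 \<le> e * s h c" using calculation e(1) by simp
          ultimately show ?thesis unfolding z_def s_affine by (simp add: algebra_simps)
        qed
        ultimately have "z \<in> P" using P_eq by auto
        moreover have "c \<in> open_segment y z"
        proof -
          \<comment> \<open>The solution of \<open>c = (1 - t) y + t z\<close> for the point
            \<open>z\<close> above.\<close>
          define t where "t = 1 / (1 + e)"
          have t: "0 < t" "t < 1" "t * (1 + e) = 1" using e by (auto simp: t_def)
          have "(1 - t) *\<^sub>R y + t *\<^sub>R z = (1 - t - t * e) *\<^sub>R y + (t * (1 + e)) *\<^sub>R c"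
            by (simp add: z_def algebra_simps)
          also have "\<dots> = c" using t(3) by (simp add: algebra_simps)
          finally have eq: "c = (1 - t) *\<^sub>R y + t *\<^sub>R z" by simp
          have "y \<noteq> z"
          proof
            assume "y = z"
            then have "(1 - t) *\<^sub>R y + t *\<^sub>R z = y" by (simp add: algebra_simps)
            with eq False show False by simp
          qed
          then show ?thesis using t eq by (auto simp: in_segment)
        qed
        ultimately show ?thesis
          using F(1) y c(1) unfolding face_of_def tight_def by blast
      qed (use c in auto)
    qed
  qed
qed

end

subsection \<open>Deformations\<close>

text \<open>A linear functional minimal over \<open>P\<close> at \<open>v\<close> is minimal over
  \<open>Q\<close> at \<open>q v\<close>, so no point of \<open>Q\<close> can be separated from the
  points \<open>q v\<close>. Along an edge the summands are exchanged: \<open>q u + r v\<close> and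
  \<open>q v + r u\<close> lie in the scaled polytope and have the same midpoint as the scaled edge,
  so the face property puts both on that edge.\<close>

lemma deformation_vertex_map:
  fixes P Q :: "'a::euclidean_space set"
  assumes P: "polytope P" "P \<noteq> {}" and Q: "deformation_of Q P"
  obtains q where "Q = convex hull (q ` vertices P)"
    and "\<And>u v. u \<in> vertices P \<Longrightarrow> v \<in> vertices P \<Longrightarrow> closed_segment u v face_of P \<Longrightarrow>
      \<exists>l\<ge>0. q u - q v = l *\<^sub>R (u - v)"
proof -
  obtain c R where c: "c > 0" and R: "polytope R" and eq: "(\<lambda>x. c *\<^sub>R x) ` P = Q + R"
    and "polytope Q"
    using Q by (auto simp: deformation_of_def)
  let ?V = "vertices P"
  have VP: "?V \<subseteq> P" by (auto simp: extreme_point_of_def)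
  have hull: "P = convex hull ?V"
    by (intro Krein_Milman_Minkowski polytope_imp_compact polytope_imp_convex P)
  have "\<forall>v\<in>?V. \<exists>q r. q \<in> Q \<and> r \<in> R \<and> c *\<^sub>R v = q + r"
  proof
    fix v assume "v \<in> ?V"
    then have "c *\<^sub>R v \<in> Q + R" using VP eq by blast
    then show "\<exists>q r. q \<in> Q \<and> r \<in> R \<and> c *\<^sub>R v = q + r" by (rule set_plus_elim) blast
  qed
  then obtain q r where qr: "\<And>v. v \<in> ?V \<Longrightarrow> q v \<in> Q" "\<And>v. v \<in> ?V \<Longrightarrow> r v \<in> R"
    "\<And>v. v \<in> ?V \<Longrightarrow> c *\<^sub>R v = q v + r v"
    by metis
  have scaled: "\<exists>x\<in>P. a + b = c *\<^sub>R x" if "a \<in> Q" "b \<in> R" for a b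
    using set_plus_intro[OF that] unfolding eq[symmetric] by auto
  have hull_Q: "Q = convex hull (q ` ?V)"
  proof
    show "convex hull (q ` ?V) \<subseteq> Q"
      using qr \<open>polytope Q\<close> by (intro hull_minimal polytope_imp_convex) auto
    show "Q \<subseteq> convex hull (q ` ?V)"
    proof (rule ccontr)
      assume "\<not> Q \<subseteq> convex hull (q ` ?V)"
      then obtain z where z: "z \<in> Q" "z \<notin> convex hull (q ` ?V)" by blast
      have "closed (convex hull (q ` ?V))"
        by (intro compact_imp_closed finite_imp_compact_convex_hull finite_imageI finite_vertices P)
      then obtain a b where ab: "a \<bullet> z < b" "\<And>x. x \<in> convex hull (q ` ?V) \<Longrightarrow> b < a \<bullet> x"
        using separating_hyperplane_closed_point[OF convex_convex_hull _ z(2)] by blast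
      have "finite ?V" "?V \<noteq> {}" using finite_vertices P hull by auto
      then obtain v where v: "v \<in> ?V" "\<forall>w\<in>?V. a \<bullet> v \<le> a \<bullet> w"
        using obtains_MIN[of ?V "\<lambda>w. a \<bullet> w"] Min_le[of "(\<lambda>w. a \<bullet> w) ` ?V"] by (metis finite_imageI imageI)
      have "convex hull ?V \<subseteq> {x. a \<bullet> x \<ge> a \<bullet> v}"
        using v by (intro hull_minimal convex_halfspace_ge) auto
      then have min: "\<And>x. x \<in> P \<Longrightarrow> a \<bullet> v \<le> a \<bullet> x" using hull by auto
      \<comment> \<open>Adding \<open>r v\<close> to both \<open>z\<close> and \<open>q v\<close>
        carries the comparison from \<open>Q\<close> to the scaled \<open>P\<close>, where
        \<open>v\<close> is the minimiser.\<close>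
      obtain x where x: "x \<in> P" "z + r v = c *\<^sub>R x" using scaled z(1) qr(2) v(1) by blast
      have "c * (a \<bullet> v) \<le> c * (a \<bullet> x)" using min x(1) c by simp
      then have "a \<bullet> (c *\<^sub>R v) \<le> a \<bullet> (c *\<^sub>R x)" by simp
      then have "a \<bullet> q v \<le> a \<bullet> z"
        unfolding qr(3)[OF v(1)] x(2)[symmetric] by (simp add: inner_add_right)
      moreover have "b < a \<bullet> q v" using ab(2) v(1) hull_inc[of "q v" "q ` ?V"] by blast
      ultimately show False using ab(1) by linarith
    qed
  qed
  have edge: "\<exists>l\<ge>0. q u - q v = l *\<^sub>R (u - v)"
    if u: "u \<in> ?V" and v: "v \<in> ?V" and face: "closed_segment u v face_of P" for u v
  proof -
    obtain x where x: "x \<in> P" "q u + r v = c *\<^sub>R x" using scaled qr u v by blast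
    obtain y where y: "y \<in> P" "q v + r u = c *\<^sub>R y" using scaled qr u v by blast
    have "c *\<^sub>R (x + y) = c *\<^sub>R (u + v)"
      using qr(3)[OF u] qr(3)[OF v] x(2)[symmetric] y(2)[symmetric] by (simp add: algebra_simps)
    then have xy: "x + y = u + v" using c by simp
    have mid: "midpoint x y \<in> closed_segment u v"
      using midpoint_in_closed_segment[of u v] by (simp add: midpoint_def xy)
    have "x \<in> closed_segment u v"
    proof (cases "x = y")
      case False
      then have "midpoint x y \<in> open_segment x y" by simp
      then show ?thesis using face mid x(1) y(1) unfolding face_of_def by blast
    qed (use mid in simp)
    then obtain t where t: "0 \<le> t" "x = (1 - t) *\<^sub>R v + t *\<^sub>R u"
      by (auto simp: closed_segment_commute[of u v] in_segment)
    \<comment> \<open>The summand \<open>r v\<close> is common to \<open>q u + r v\<close> and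
      \<open>q v + r v\<close> and cancels.\<close>
    have "q u - q v = c *\<^sub>R x - c *\<^sub>R v"
      using x(2) qr(3)[OF v] by (simp add: algebra_simps)
    also have "\<dots> = (c * t) *\<^sub>R (u - v)" by (simp add: t(2) algebra_simps)
    finally show ?thesis using c t(1) by (intro exI[of _ "c * t"]) auto
  qed
  show thesis using that[OF hull_Q] edge by blast
qed

lemma indecomposableI_vertex_map:
  fixes P :: "'a::euclidean_space set"
  assumes P: "polytope P" "P \<noteq> {}"
    and rigid: "\<And>q :: 'a \<Rightarrow> 'a. (\<And>u v. u \<in> vertices P \<Longrightarrow> v \<in> vertices P \<Longrightarrow> closed_segment u v face_of P \<Longrightarrow>
      \<exists>l\<ge>0. q u - q v = l *\<^sub>R (u - v)) \<Longrightarrow> \<exists>l\<ge>0. \<exists>t. \<forall>v\<in>vertices P. q v = l *\<^sub>R v + t"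
  shows "indecomposable P"
  unfolding indecomposable_def
proof (intro conjI allI impI)
  show "polytope P" by fact
  fix Q assume "deformation_of Q P"
  with P obtain q where q: "Q = convex hull (q ` vertices P)"
    "\<And>u v. u \<in> vertices P \<Longrightarrow> v \<in> vertices P \<Longrightarrow> closed_segment u v face_of P \<Longrightarrow>
      \<exists>l\<ge>0. q u - q v = l *\<^sub>R (u - v)"
    using deformation_vertex_map[of P Q] by (metis (lifting))
  from rigid[OF q(2)] obtain l t where l: "l \<ge> 0" "\<forall>v\<in>vertices P. q v = l *\<^sub>R v + t"
    by blast
  have "q ` vertices P = (\<lambda>x. t + l *\<^sub>R x) ` vertices P"
    using l(2) by (intro image_cong) (auto simp: add.commute)
  then have "Q = (\<lambda>x. t + l *\<^sub>R x) ` (convex hull vertices P)"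
    unfolding q(1) by (simp add: convex_hull_affinity)
  moreover have "convex hull vertices P = P"
    by (intro Krein_Milman_Minkowski[symmetric] polytope_imp_compact polytope_imp_convex P)
  ultimately show "\<exists>c\<ge>0. \<exists>t. Q = (\<lambda>x. c *\<^sub>R x + t) ` P"
    using l(1) by (intro exI[of _ l] conjI exI[of _ t]) (auto simp: add.commute)
qed

subsection \<open>Executable incidence checks\<close>

text \<open>Rows of the incidence matrix get a datatype of their own because this keeps the terms that
  \<open>code_simp\<close> has to traverse much smaller than Boolean lists would.\<close>

datatype bits = End | B0 bits | B1 bits

fun row :: "('h \<Rightarrow> 'p \<Rightarrow> bool) \<Rightarrow> 'h list \<Rightarrow> 'p \<Rightarrow> bits" where
  "row inc [] v = End"
| "row inc (h # H) v = (if inc h v then B1 (row inc H v) else B0 (row inc H v))"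

fun below :: "bits \<Rightarrow> bits \<Rightarrow> bool" where
  "below (B1 x) (B0 y) = False"
| "below (B1 x) (B1 y) = below x y"
| "below (B0 x) (B1 y) = below x y"
| "below (B0 x) (B0 y) = below x y"
| "below _ _ = True"

fun meet :: "bits \<Rightarrow> bits \<Rightarrow> bits" where
  "meet (B1 x) (B0 y) = B0 (meet x y)"
| "meet (B1 x) (B1 y) = B1 (meet x y)"
| "meet (B0 x) (B1 y) = B0 (meet x y)"
| "meet (B0 x) (B0 y) = B0 (meet x y)"
| "meet _ _ = End"

fun at_most_above :: "nat \<Rightarrow> bits \<Rightarrow> bits list \<Rightarrow> bool" where
  "at_most_above n r [] = True"
| "at_most_above n r (x # xs) =
     (if below r x then (case n of 0 \<Rightarrow> False | Suc m \<Rightarrow> at_most_above m r xs)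
      else at_most_above n r xs)"

text \<open>Two vertices always lie on their own common facets; the bound two therefore says that no
  third vertex does.\<close>

fun edges_from :: "bits list \<Rightarrow> bits \<Rightarrow> bits list \<Rightarrow> nat" where
  "edges_from R r [] = 0"
| "edges_from R r (x # xs) =
     (if at_most_above (Suc (Suc 0)) (meet r x) R then Suc (edges_from R r xs) else edges_from R r xs)"

fun edge_count :: "bits list \<Rightarrow> bits list \<Rightarrow> nat" where
  "edge_count R [] = 0"
| "edge_count R (r # rs) = edges_from R r rs + edge_count R rs"

definition zeros :: "('h \<Rightarrow> 'p \<Rightarrow> bool) \<Rightarrow> 'h \<Rightarrow> 'p list \<Rightarrow> 'p list" where
  "zeros inc h V = filter (\<lambda>v. inc h v) V"

text \<open>A proper face of a 4-polytope is a facet if it properly contains a face with at least three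
  vertices, because the latter has dimension at least two.\<close>

fun broad :: "('h \<Rightarrow> 'p \<Rightarrow> bool) \<Rightarrow> 'h list \<Rightarrow> 'p list \<Rightarrow> bool" where
  "broad inc [] F = False"
| "broad inc (g # H) F =
     (if 3 \<le> length (zeros inc g F) \<and> length (zeros inc g F) < length F then True else broad inc H F)"

definition ridges_in :: "('h \<Rightarrow> 'p \<Rightarrow> bool) \<Rightarrow> 'p list \<Rightarrow> 'h list \<Rightarrow> 'p list list" where
  "ridges_in inc F H = filter (\<lambda>X. 3 \<le> length X) (map (\<lambda>g. zeros inc g F) H)"

fun ridges :: "('h \<Rightarrow> 'p \<Rightarrow> bool) \<Rightarrow> 'h list \<Rightarrow> 'p list \<Rightarrow> 'p list list" where
  "ridges inc [] V = []"
| "ridges inc (h # H) V = ridges_in inc (zeros inc h V) H @ ridges inc H V"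

text \<open>Distinct zero lists make the listed inequalities define different facets, and a list
  shorter than \<open>V\<close> makes each tight set proper. Distinct ridges express that a 2-face
  lies in exactly one pair of facets, so that the list length counts 2-faces.\<close>

definition facets_ok :: "('h \<Rightarrow> 'p \<Rightarrow> bool) \<Rightarrow> 'h list \<Rightarrow> 'p list \<Rightarrow> bool" where
  "facets_ok inc H V \<longleftrightarrow> H \<noteq> [] \<and> distinct (map (\<lambda>h. zeros inc h V) H) \<and>
     list_all (\<lambda>F. length F < length V \<and> broad inc H F) (map (\<lambda>h. zeros inc h V) H) \<and>
     distinct (ridges inc H V)"

definition adjacent :: "('h \<Rightarrow> 'p \<Rightarrow> bool) \<Rightarrow> 'h list \<Rightarrow> bits list \<Rightarrow> 'p \<Rightarrow> 'p \<Rightarrow> bool" where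
  "adjacent inc H R u v \<longleftrightarrow> at_most_above (Suc (Suc 0)) (meet (row inc H u) (row inc H v)) R"

text \<open>The order within a pair matters. In the triangle case \<open>w\<close> is the endpoint
  shared with the known edge and \<open>z\<close> is the apex; in the parallelogram case
  \<open>z\<close> is the translate of \<open>u\<close> and \<open>w\<close> that of
  \<open>v\<close>. Only the closing up of the edges is tested, not that they bound a
  2-face.\<close>

definition forces :: "('h \<Rightarrow> 'p::minus \<Rightarrow> bool) \<Rightarrow> 'h list \<Rightarrow> bits list \<Rightarrow> 'p \<Rightarrow> 'p \<Rightarrow> 'p \<Rightarrow> 'p \<Rightarrow> bool" where
  "forces inc H R u v z w =
     (if w = u \<or> w = v
      then z \<noteq> u \<and> z \<noteq> v \<and> adjacent inc H R u z \<and> adjacent inc H R v z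
      else if z - u = w - v
      then z \<noteq> u \<and> z \<noteq> w \<and> adjacent inc H R u z \<and> adjacent inc H R v w \<and> adjacent inc H R z w
      else False)"

fun forced_by :: "('h \<Rightarrow> 'p::minus \<Rightarrow> bool) \<Rightarrow> 'h list \<Rightarrow> bits list \<Rightarrow> ('p \<times> 'p) list \<Rightarrow> 'p \<Rightarrow> 'p \<Rightarrow> bool" where
  "forced_by inc H R [] z w = False"
| "forced_by inc H R (e # E) z w =
     (if forces inc H R (fst e) (snd e) z w then True else forced_by inc H R E z w)"

fun forced_order :: "('h \<Rightarrow> 'p::minus \<Rightarrow> bool) \<Rightarrow> 'h list \<Rightarrow> bits list \<Rightarrow> ('p \<times> 'p) list \<Rightarrow> ('p \<times> 'p) list \<Rightarrow> bool" where
  "forced_order inc H R E [] = True"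
| "forced_order inc H R E (e # es) =
     (if forced_by inc H R E (fst e) (snd e) then forced_order inc H R (e # E) es else False)"

fun spanning :: "('p \<times> 'p) list \<Rightarrow> 'p list \<Rightarrow> 'p list \<Rightarrow> bool" where
  "spanning E seen [] = True"
| "spanning E seen (v # vs) =
     (if list_ex (\<lambda>(x, y). if x = v then List.member seen y else if y = v then List.member seen x else False) E
      then spanning E (v # seen) vs else False)"

text \<open>Along the edges \<open>es\<close> the edge lengths of a deformation are all scaled by the same factor:
  each of them closes a triangle with an earlier edge, or is opposite to one in a parallelogram.\<close>

definition rigid_check :: "('h \<Rightarrow> 'p::minus \<Rightarrow> bool) \<Rightarrow> 'h list \<Rightarrow> bits list \<Rightarrow> 'p list \<Rightarrow> ('p \<times> 'p) list \<Rightarrow> bool" where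
  "rigid_check inc H R V es \<longleftrightarrow>
     (case es of [] \<Rightarrow> False | (u, v) # es' \<Rightarrow>
       u \<noteq> v \<and> adjacent inc H R u v \<and> forced_order inc H R [(u, v)] es' \<and>
       list_all (\<lambda>(x, y). List.member V x \<and> List.member V y) es \<and>
       spanning es [hd V] (tl V))"

section \<open>What the list computations decide and count\<close>

lemma below_row: "below (row inc H u) (row inc H w) \<longleftrightarrow> (\<forall>h\<in>set H. inc h u \<longrightarrow> inc h w)"
  by (induction H) auto

lemma below_meet_row:
  "below (meet (row inc H u) (row inc H v)) (row inc H w) \<longleftrightarrow>
     (\<forall>h\<in>set H. inc h u \<and> inc h v \<longrightarrow> inc h w)"
  by (induction H) auto

lemma at_most_above_iff: "at_most_above n r xs \<longleftrightarrow> length (filter (below r) xs) \<le> n"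
  by (induction xs arbitrary: n) (auto split: nat.splits)

lemma at_most_above_rows:
  assumes "distinct V"
  shows "at_most_above n r (map (row inc H) V) \<longleftrightarrow> card {w \<in> set V. below r (row inc H w)} \<le> n"
proof -
  have "length (filter (below r) (map (row inc H) V)) = length (filter (\<lambda>w. below r (row inc H w)) V)"
    by (simp add: filter_map o_def)
  also have "\<dots> = card {w \<in> set V. below r (row inc H w)}"
    using assms by (metis distinct_card distinct_filter set_filter)
  finally show ?thesis by (simp add: at_most_above_iff)
qed

lemma edges_from_eq:
  "edges_from R r (map f vs) = length (filter (\<lambda>v. at_most_above (Suc (Suc 0)) (meet r (f v)) R) vs)"
  by (induction vs) auto

text \<open>\<open>R\<close> stays fixed while the list shrinks in the induction, so every pair is
  tested against all rows and not only against the remaining ones.\<close>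

lemma edge_count_eq:
  assumes "distinct vs" and sym: "\<And>u v. Q u v = Q v u"
    and Q: "\<And>u v. Q u v \<longleftrightarrow> at_most_above (Suc (Suc 0)) (meet (f u) (f v)) R"
  shows "edge_count R (map f vs) = card {X. \<exists>u\<in>set vs. \<exists>v\<in>set vs. u \<noteq> v \<and> X = {u, v} \<and> Q u v}"
  using assms(1)
proof (induction vs)
  case (Cons x xs)
  let ?new = "(\<lambda>v. {x, v}) ` {v \<in> set xs. Q x v}"
  let ?old = "{X. \<exists>u\<in>set xs. \<exists>v\<in>set xs. u \<noteq> v \<and> X = {u, v} \<and> Q u v}"
  have split: "{X. \<exists>u\<in>set (x # xs). \<exists>v\<in>set (x # xs). u \<noteq> v \<and> X = {u, v} \<and> Q u v} = ?new \<union> ?old"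
  proof (intro equalityI subsetI)
    fix X assume "X \<in> {X. \<exists>u\<in>set (x # xs). \<exists>v\<in>set (x # xs). u \<noteq> v \<and> X = {u, v} \<and> Q u v}"
    then obtain u v where *: "u \<in> set (x # xs)" "v \<in> set (x # xs)" "u \<noteq> v" "X = {u, v}" "Q u v"
      by blast
    then consider "u = x" "v \<in> set xs" | "v = x" "u \<in> set xs" | "u \<in> set xs" "v \<in> set xs" by auto
    then show "X \<in> ?new \<union> ?old"
    proof cases
      case 2
      then have "X = {x, u}" "Q x u" using * sym[of u x] by auto
      then show ?thesis using 2 by blast
    qed (use * in blast)+
  next
    fix X assume "X \<in> ?new \<union> ?old"
    then show "X \<in> {X. \<exists>u\<in>set (x # xs). \<exists>v\<in>set (x # xs). u \<noteq> v \<and> X = {u, v} \<and> Q u v}"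
    proof
      assume "X \<in> ?new"
      then obtain v where "v \<in> set xs" "Q x v" "X = {x, v}" by blast
      moreover from this have "x \<noteq> v" using Cons.prems by auto
      ultimately show ?thesis by auto
    next
      assume "X \<in> ?old"
      then show ?thesis by (simp only: mem_Collect_eq list.set) blast
    qed
  qed
  have "?old \<subseteq> (\<lambda>(u, v). {u, v}) ` (set xs \<times> set xs)" by auto
  then have fin: "finite ?old" by (rule finite_subset) auto
  have disj: "?new \<inter> ?old = {}" using Cons.prems by (auto simp: doubleton_eq_iff)
  have "inj_on (\<lambda>v. {x, v}) {v \<in> set xs. Q x v}"
    using Cons.prems by (auto simp: inj_on_def doubleton_eq_iff)
  then have "card ?new = card {v \<in> set xs. Q x v}" by (rule card_image)
  also have "\<dots> = length (filter (Q x) xs)"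
    using Cons.prems by (metis distinct.simps(2) distinct_card distinct_filter set_filter)
  also have "\<dots> = edges_from R (f x) (map f xs)"
    unfolding edges_from_eq by (intro arg_cong[of _ _ length] filter_cong) (auto simp: Q)
  finally show ?case
    using Cons unfolding split by (subst card_Un_disjoint) (auto simp: fin disj)
qed simp

lemma broad_imp:
  "broad inc H F \<Longrightarrow> \<exists>g\<in>set H. 3 \<le> length (zeros inc g F) \<and> length (zeros inc g F) < length F"
  by (induction H) (auto split: if_splits)

lemma zeros_zeros: "zeros inc g (zeros inc h V) = filter (\<lambda>v. inc g v \<and> inc h v) V"
  by (simp add: zeros_def conj_commute)

lemma set_ridges:
  assumes "distinct H"
  shows "set (ridges inc H V) =
    {filter (\<lambda>v. inc g v \<and> inc h v) V |g h. g \<in> set H \<and> h \<in> set H \<and> g \<noteq> h \<and>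
       3 \<le> length (filter (\<lambda>v. inc g v \<and> inc h v) V)}"
proof -
  define f where "f g h = filter (\<lambda>v. inc g v \<and> inc h v) V" for g h
  have comm: "f g h = f h g" for g h
    unfolding f_def by (intro filter_cong) auto
  have "set (ridges inc H V) = {f g h |g h. g \<in> set H \<and> h \<in> set H \<and> g \<noteq> h \<and> 3 \<le> length (f g h)}"
    using assms
  proof (induction H)
    case Nil
    show ?case by simp
  next
    case (Cons k H)
    have "set (ridges_in inc (zeros inc k V) H) = {X \<in> (\<lambda>g. f g k) ` set H. 3 \<le> length X}"
      by (simp only: ridges_in_def zeros_zeros set_filter set_map f_def)
    then have eq: "set (ridges inc (k # H) V) =
        {X \<in> (\<lambda>g. f g k) ` set H. 3 \<le> length X} \<union>
        {f g h |g h. g \<in> set H \<and> h \<in> set H \<and> g \<noteq> h \<and> 3 \<le> length (f g h)}"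
      using Cons by simp
    show ?case
    proof (intro equalityI subsetI)
      fix X assume "X \<in> set (ridges inc (k # H) V)"
      then consider g where "g \<in> set H" "X = f g k" "3 \<le> length X"
        | g h where "g \<in> set H" "h \<in> set H" "g \<noteq> h" "X = f g h" "3 \<le> length X"
        unfolding eq by blast
      then show "X \<in> {f g h |g h. g \<in> set (k # H) \<and> h \<in> set (k # H) \<and> g \<noteq> h \<and> 3 \<le> length (f g h)}"
      proof cases
        case (1 g)
        then show ?thesis using Cons.prems
          by (intro CollectI exI[of _ g] exI[of _ k]) (auto simp del: split_paired_Ex)
      next
        case (2 g h)
        then show ?thesis by (intro CollectI exI[of _ g] exI[of _ h]) simp
      qed
    next
      fix X assume "X \<in> {f g h |g h. g \<in> set (k # H) \<and> h \<in> set (k # H) \<and> g \<noteq> h \<and> 3 \<le> length (f g h)}"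
      then obtain g h where gh: "X = f g h" "g \<in> set (k # H)" "h \<in> set (k # H)" "g \<noteq> h" "3 \<le> length X"
        by blast
      then consider "h = k" "g \<in> set H" | "g = k" "h \<in> set H" | "g \<in> set H" "h \<in> set H" by auto
      then show "X \<in> set (ridges inc (k # H) V)"
        unfolding eq using gh(1,4,5) comm by cases blast+
    qed
  qed
  then show ?thesis by (simp only: f_def)
qed

subsection \<open>Soundness of the checks\<close>

text \<open>The type \<open>'p\<close> holds the combinatorial data on which the checks run, and
  \<open>p\<close> realises it in space; \<open>p_diff\<close> lets parallelograms be recognised in
  \<open>'p\<close>. Dimension is only bounded from above here, since \<open>facets_ok\<close>
  forces the lower bound.\<close>

locale incidence_model = halfspace_polytope P A "set H" s
  for P A :: "'a::euclidean_space set" and H :: "'h list" and s +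
  fixes p :: "'p::minus \<Rightarrow> 'a" and V :: "'p list" and inc :: "'h \<Rightarrow> 'p \<Rightarrow> bool"
  assumes s_p_eq_0_iff: "\<And>h v. h \<in> set H \<Longrightarrow> s h (p v) = 0 \<longleftrightarrow> inc h v"
    and inj_p: "inj p"
    and p_diff: "\<And>u v z w. z - u = w - v \<Longrightarrow> p z - p u = p w - p v"
    and vertices_P: "vertices P = p ` set V"
    and distinct_V: "distinct V"
    and aff_dim_P_le: "aff_dim P \<le> 4"
    and facets_ok: "facets_ok inc H V"
begin

definition Z :: "'h set \<Rightarrow> 'p set" where
  "Z S = {v \<in> set V. \<forall>h\<in>S. inc h v}"

lemma p_eq_iff [simp]: "p u = p v \<longleftrightarrow> u = v"
  using inj_p by (auto simp: inj_def)

lemma p_in_P: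
  assumes "v \<in> set V"
  shows "p v \<in> P"
proof -
  have "p v \<in> vertices P" unfolding vertices_P using assms by (rule imageI)
  then show ?thesis by (simp add: extreme_point_of_def)
qed

lemma p_in_tight: "v \<in> set V \<Longrightarrow> S \<subseteq> set H \<Longrightarrow> p v \<in> tight S \<longleftrightarrow> v \<in> Z S"
  using p_in_P by (auto simp: tight_def Z_def s_p_eq_0_iff subset_iff)

lemma vertices_tight: "S \<subseteq> set H \<Longrightarrow> vertices P \<inter> tight S = p ` Z S"
  unfolding vertices_P using p_in_tight by (auto simp: Z_def)

lemma tight_eq_iff:
  assumes "S \<subseteq> set H" "S' \<subseteq> set H"
  shows "tight S = tight S' \<longleftrightarrow> Z S = Z S'"
proof
  assume "tight S = tight S'"
  then have "p ` Z S = p ` Z S'" using vertices_tight assms by metis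
  then show "Z S = Z S'" using inj_image_eq_iff inj_p by metis
next
  assume "Z S = Z S'"
  then show "tight S = tight S'"
    using face_eqI_vertices[OF polytope_P] tight_face_of vertices_tight assms by metis
qed

lemma tight_dim_ge_2: "S \<subseteq> set H \<Longrightarrow> 2 \<le> aff_dim (tight S) \<longleftrightarrow> 3 \<le> card (Z S)"
  unfolding face_dim_ge_2_iff[OF polytope_P tight_face_of] vertices_tight
  by (simp add: card_image inj_on_def)

lemma tight_dim_less:
  assumes "S \<subseteq> S'" "S' \<subseteq> set H" "Z S' \<noteq> Z S"
  shows "aff_dim (tight S') < aff_dim (tight S)"
proof -
  have S: "S \<subseteq> set H" using assms by auto
  have "tight S' \<subseteq> tight S" using assms(1) by (auto simp: tight_def)
  moreover have "tight S \<subseteq> P" by (auto simp: tight_def)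
  ultimately have "tight S' face_of tight S"
    using face_of_subset tight_face_of[OF assms(2)] by blast
  moreover have "convex (tight S)" using face_of_imp_convex tight_face_of[OF S] by blast
  moreover have "tight S' \<noteq> tight S" using tight_eq_iff[OF assms(2) S] assms(3) by simp
  ultimately show ?thesis using face_of_aff_dim_lt by blast
qed

lemma card_Z: "card {v \<in> set V. Q v} = length (filter Q V)"
  using distinct_V by (metis distinct_card distinct_filter set_filter)

lemma card_Z1: "card (Z {h}) = length (zeros inc h V)"
  by (simp add: Z_def zeros_def card_Z)

lemma Z_pair: "Z {g, h} = {v \<in> set V. inc g v \<and> inc h v}"
  by (auto simp: Z_def)

lemma Z_pair_less:
  assumes "h \<in> set H"
  obtains g where "g \<in> set H" "3 \<le> card (Z {g, h})" "card (Z {g, h}) < card (Z {h})"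
proof -
  have "broad inc H (zeros inc h V)" using facets_ok assms by (auto simp: facets_ok_def list_all_iff)
  then obtain g where "g \<in> set H" "3 \<le> length (zeros inc g (zeros inc h V))"
    "length (zeros inc g (zeros inc h V)) < length (zeros inc h V)"
    using broad_imp by blast
  then show thesis using that by (simp add: card_Z1 Z_pair card_Z zeros_zeros)
qed

lemma distinct_H: "distinct H"
  using facets_ok by (auto simp: facets_ok_def distinct_map)

lemma Z1_inj:
  assumes "g \<in> set H" "h \<in> set H" "Z {g} = Z {h}"
  shows "g = h"
proof -
  have "\<forall>v\<in>set V. inc g v \<longleftrightarrow> inc h v" using assms(3) unfolding Z_def by blast
  then have "zeros inc g V = zeros inc h V"
    unfolding zeros_def by (intro filter_cong) auto
  then show ?thesis using facets_ok assms by (auto simp: facets_ok_def distinct_map inj_on_def)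
qed

text \<open>Three vertices give \<open>tight {g, h}\<close> dimension at least 2, and the two strict
  inclusions of faces up to \<open>tight {h}\<close> and then \<open>P\<close> raise it by at least
  one each. The upper bound 4 leaves no slack in this chain.\<close>

lemma dim_P_facets: "aff_dim P = 4 \<and> (\<forall>h\<in>set H. aff_dim (tight {h}) = 3)"
proof -
  have *: "3 \<le> aff_dim (tight {h}) \<and> aff_dim (tight {h}) < aff_dim P" if h: "h \<in> set H" for h
  proof
    obtain g where g: "g \<in> set H" "3 \<le> card (Z {g, h})" "card (Z {g, h}) < card (Z {h})"
      using Z_pair_less h by blast
    then have "2 \<le> aff_dim (tight {g, h})" using h tight_dim_ge_2 by simp
    moreover have "aff_dim (tight {g, h}) < aff_dim (tight {h})"
      using g h by (intro tight_dim_less) auto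
    ultimately show "3 \<le> aff_dim (tight {h})" by simp
    have "length (zeros inc h V) < length V" using facets_ok h by (auto simp: facets_ok_def list_all_iff)
    then have "card (Z {h}) < card (Z {})" using card_Z1 distinct_card[OF distinct_V] by (simp add: Z_def)
    then have "aff_dim (tight {h}) < aff_dim (tight {})" using h by (intro tight_dim_less) auto
    then show "aff_dim (tight {h}) < aff_dim P" by (simp add: tight_empty)
  qed
  have "H \<noteq> []" using facets_ok by (simp add: facets_ok_def)
  then have "aff_dim P = 4" using *[of "hd H"] aff_dim_P_le by simp
  moreover have "aff_dim (tight {h}) = 3" if "h \<in> set H" for h
    using *[OF that] \<open>aff_dim P = 4\<close> by linarith
  ultimately show ?thesis by blast
qed

lemma proper_face_eq_tight:
  assumes "F face_of P" "F \<noteq> {}" "F \<noteq> P"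
  shows "\<exists>S h. S \<subseteq> set H \<and> h \<in> S \<and> F = tight S"
proof -
  obtain S where S: "S \<subseteq> set H" "F = tight S" using face_eq_tight assms by blast
  then have "S \<noteq> {}" using assms(3) tight_empty by metis
  then show ?thesis using S by blast
qed

text \<open>A facet is contained in \<open>tight {h}\<close> for any inequality \<open>h\<close>
  that is tight on it. Both have dimension 3, so the inclusion cannot be strict.\<close>

lemma facets_eq: "{F. F facet_of P} = (\<lambda>h. tight {h}) ` set H"
proof
  show "(\<lambda>h. tight {h}) ` set H \<subseteq> {F. F facet_of P}"
  proof
    fix F assume "F \<in> (\<lambda>h. tight {h}) ` set H"
    then obtain h where h: "h \<in> set H" "F = tight {h}" by blast
    then have "F face_of P" "aff_dim F = 3" "aff_dim P = 4" using tight_face_of[of "{h}"] dim_P_facets by auto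
    moreover from this have "F \<noteq> {}" by auto
    ultimately show "F \<in> {F. F facet_of P}" by (simp add: facet_of_def)
  qed
  show "{F. F facet_of P} \<subseteq> (\<lambda>h. tight {h}) ` set H"
  proof
    fix F assume "F \<in> {F. F facet_of P}"
    then have F: "F face_of P" "F \<noteq> {}" "aff_dim F = 3"
      using dim_P_facets by (simp_all add: facet_of_def)
    then have "F \<noteq> P" using dim_P_facets by auto
    then obtain S h where h: "S \<subseteq> set H" "h \<in> S" "F = tight S" using proper_face_eq_tight[OF F(1,2) \<open>F \<noteq> P\<close>] by blast
    have "Z S = Z {h}"
    proof (rule ccontr)
      assume "Z S \<noteq> Z {h}"
      then have "aff_dim (tight S) < aff_dim (tight {h})" using h by (intro tight_dim_less) auto
      moreover have "aff_dim (tight {h}) = 3" using h dim_P_facets by blast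
      ultimately show False using F(3) h(3) by simp
    qed
    then have "F = tight {h}" using h(3) tight_eq_iff[of S "{h}"] h(1,2) by blast
    then show "F \<in> (\<lambda>h. tight {h}) ` set H" using h(1,2) by blast
  qed
qed

lemma num_facets: "num_facets P = length H"
proof -
  have "inj_on (\<lambda>h. tight {h}) (set H)"
  proof (rule inj_onI)
    fix g h assume *: "g \<in> set H" "h \<in> set H" "tight {g} = tight {h}"
    then have "Z {g} = Z {h}" using tight_eq_iff[of "{g}" "{h}"] by simp
    then show "g = h" using Z1_inj * by blast
  qed
  then show ?thesis
    unfolding num_facets_def facets_eq using distinct_H by (simp add: card_image distinct_card)
qed

lemma num_vertices: "num_vertices P = length V"
  unfolding num_vertices_def vertices_P using distinct_V by (simp add: card_image inj_on_def distinct_card)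

text \<open>If the intersection were all of one facet, that facet would be a proper face of the
  other, although both have dimension 3.\<close>

lemma ridge_dim_le:
  assumes "g \<in> set H" "h \<in> set H" "g \<noteq> h"
  shows "aff_dim (tight {g, h}) \<le> 2"
proof -
  have "Z {g, h} \<noteq> Z {g}"
  proof
    assume "Z {g, h} = Z {g}"
    then have "Z {g, h} \<noteq> Z {h}" using Z1_inj assms by metis
    then have "aff_dim (tight {g, h}) < aff_dim (tight {h})" using assms by (intro tight_dim_less) auto
    moreover have "tight {g, h} = tight {g}" using \<open>Z {g, h} = Z {g}\<close> tight_eq_iff[of "{g, h}" "{g}"] assms by simp
    ultimately show False using dim_P_facets assms by simp
  qed
  then have "aff_dim (tight {g, h}) < aff_dim (tight {g})" using assms by (intro tight_dim_less) auto
  then show ?thesis using dim_P_facets assms by simp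
qed

text \<open>Beside one facet containing the 2-face, some second tight inequality does not hold with
  equality on all of that facet. These two already cut the dimension down to 2, so the remaining
  tight inequalities cannot shrink the face further.\<close>

lemma ridges_eq:
  "{F. F face_of P \<and> aff_dim F = 2} =
    {tight {g, h} |g h. g \<in> set H \<and> h \<in> set H \<and> g \<noteq> h \<and> 3 \<le> card (Z {g, h})}" (is "?L = ?R")
proof
  show "?R \<subseteq> ?L"
  proof
    fix F assume "F \<in> ?R"
    then obtain g h where "F = tight {g, h}" "g \<in> set H" "h \<in> set H" "g \<noteq> h" "3 \<le> card (Z {g, h})" by blast
    then show "F \<in> ?L" using ridge_dim_le[of g h] tight_dim_ge_2[of "{g, h}"] tight_face_of[of "{g, h}"] by simp
  qed
  show "?L \<subseteq> ?R"
  proof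
    fix F assume F: "F \<in> ?L"
    then have "F face_of P" "aff_dim F = 2" by auto
    then have "F \<noteq> {}" "F \<noteq> P" using dim_P_facets by auto
    then obtain S g where S: "S \<subseteq> set H" "g \<in> S" "F = tight S"
      using proper_face_eq_tight[OF \<open>F face_of P\<close> \<open>F \<noteq> {}\<close> \<open>F \<noteq> P\<close>] by blast
    have "aff_dim (tight {g}) = 3" using S dim_P_facets by blast
    then have "tight S \<noteq> tight {g}" using \<open>aff_dim F = 2\<close> S(3) by auto
    then obtain h where h: "h \<in> S" "\<not> tight {g} \<subseteq> tight {h}" using S(2) by (auto simp: tight_def)
    then have "h \<noteq> g" by auto
    have gh: "g \<in> set H" "h \<in> set H" using S h by auto
    have "Z S = Z {g, h}"
    proof (rule ccontr)
      assume "Z S \<noteq> Z {g, h}"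
      then have "aff_dim (tight S) < aff_dim (tight {g, h})" using S h by (intro tight_dim_less) auto
      then show False using ridge_dim_le[OF gh] \<open>h \<noteq> g\<close> S(3) \<open>aff_dim F = 2\<close> by simp
    qed
    then have eq: "F = tight {g, h}" using S(1,3) gh tight_eq_iff[of S "{g, h}"] by simp
    moreover have "3 \<le> card (Z {g, h})"
      using tight_dim_ge_2[of "{g, h}"] gh \<open>aff_dim F = 2\<close> eq by simp
    ultimately show "F \<in> ?R" using gh \<open>h \<noteq> g\<close> by blast
  qed
qed

text \<open>A face is encoded by the list of its vertices in the order of \<open>V\<close>.
  Filtering preserves that order, so equal vertex sets are equal lists and distinctness of lists
  counts faces.\<close>

lemma num_ridges: "card {F. F face_of P \<and> aff_dim F = 2} = length (ridges inc H V)"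
proof -
  let ?f = "\<lambda>F. filter (\<lambda>v. p v \<in> F) V"
  have f: "?f (tight {g, h}) = filter (\<lambda>v. inc g v \<and> inc h v) V" if "g \<in> set H" "h \<in> set H" for g h
    using that p_in_tight[of _ "{g, h}"] by (intro filter_cong) (auto simp: Z_def)
  have "inj_on ?f {F. F face_of P \<and> aff_dim F = 2}"
  proof (rule inj_onI)
    fix F G assume *: "F \<in> {F. F face_of P \<and> aff_dim F = 2}" "G \<in> {F. F face_of P \<and> aff_dim F = 2}" "?f F = ?f G"
    have "set (?f F) = set (?f G)" using *(3) by simp
    then have "vertices P \<inter> F = vertices P \<inter> G" unfolding vertices_P by auto
    then show "F = G" using face_eqI_vertices[OF polytope_P] * by blast
  qed
  then have "card {F. F face_of P \<and> aff_dim F = 2} = card (?f ` {F. F face_of P \<and> aff_dim F = 2})"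
    by (simp add: card_image)
  also have "?f ` {F. F face_of P \<and> aff_dim F = 2} = set (ridges inc H V)"
  proof (intro equalityI subsetI)
    fix X assume "X \<in> ?f ` {F. F face_of P \<and> aff_dim F = 2}"
    then obtain g h where "g \<in> set H" "h \<in> set H" "g \<noteq> h" "3 \<le> card (Z {g, h})" "X = ?f (tight {g, h})"
      unfolding ridges_eq by blast
    then show "X \<in> set (ridges inc H V)"
      unfolding set_ridges[OF distinct_H] Z_pair card_Z using f by blast
  next
    fix X assume "X \<in> set (ridges inc H V)"
    then obtain g h where gh: "g \<in> set H" "h \<in> set H" "g \<noteq> h" "3 \<le> card (Z {g, h})"
      "X = filter (\<lambda>v. inc g v \<and> inc h v) V"
      unfolding set_ridges[OF distinct_H] Z_pair card_Z by blast
    then have "X = ?f (tight {g, h})" using f by simp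
    then show "X \<in> ?f ` {F. F face_of P \<and> aff_dim F = 2}"
      unfolding ridges_eq using gh by blast
  qed
  also have "card \<dots> = length (ridges inc H V)"
    using facets_ok by (simp add: facets_ok_def distinct_card)
  finally show ?thesis .
qed

text \<open>Imposing all inequalities tight at both \<open>u\<close> and \<open>v\<close> yields the
  smallest face containing the two points. The segment is a face exactly when this smallest face has
  no further vertex.\<close>

lemma adjacent_iff:
  assumes "u \<in> set V" "v \<in> set V" "u \<noteq> v"
  shows "adjacent inc H (map (row inc H) V) u v \<longleftrightarrow> closed_segment (p u) (p v) face_of P"
proof -
  define S where "S = {h \<in> set H. inc h u \<and> inc h v}"
  have S: "S \<subseteq> set H" by (auto simp: S_def)
  have Z: "{w \<in> set V. below (meet (row inc H u) (row inc H v)) (row inc H w)} = Z S"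
    by (auto simp: Z_def S_def below_meet_row)
  have uv: "{u, v} \<subseteq> Z S" using assms by (auto simp: Z_def S_def)
  have fin: "finite (Z S)" by (auto simp: Z_def)
  have "adjacent inc H (map (row inc H) V) u v \<longleftrightarrow> card (Z S) \<le> 2"
    by (simp add: adjacent_def at_most_above_rows[OF distinct_V] Z numeral_2_eq_2)
  also have "\<dots> \<longleftrightarrow> Z S = {u, v}"
    using card_seteq[OF fin uv] assms(3) by auto
  also have "\<dots> \<longleftrightarrow> closed_segment (p u) (p v) face_of P"
  proof
    assume "Z S = {u, v}"
    then have "tight S = convex hull {p u, p v}"
      using face_eq_hull_vertices[OF polytope_P tight_face_of[OF S]] vertices_tight[OF S] by simp
    then show "closed_segment (p u) (p v) face_of P"
      using tight_face_of[OF S] by (simp add: segment_convex_hull)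
  next
    assume face: "closed_segment (p u) (p v) face_of P"
    then obtain S' where S': "S' \<subseteq> set H" "closed_segment (p u) (p v) = tight S'"
      using face_eq_tight[OF face] ends_in_segment(1) by blast
    have "p ` Z S' = {p u, p v}"
      using vertices_segment_face[OF face] vertices_tight[OF S'(1)] S'(2) by simp
    then have "Z S' = {u, v}" using inj_image_eq_iff[OF inj_p, of "Z S'" "{u, v}"] by simp
    then have "S' \<subseteq> S" using S'(1) by (auto simp: S_def Z_def)
    then have "Z S \<subseteq> {u, v}" using \<open>Z S' = {u, v}\<close> by (auto simp: Z_def)
    then show "Z S = {u, v}" using uv by blast
  qed
  finally show ?thesis .
qed

lemma num_edges: "card {e. e edge_of P} = edge_count (map (row inc H) V) (map (row inc H) V)"
proof -
  let ?Q = "adjacent inc H (map (row inc H) V)"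
  let ?X = "{X. \<exists>u\<in>set V. \<exists>v\<in>set V. u \<noteq> v \<and> X = {u, v} \<and> ?Q u v}"
  have "edge_count (map (row inc H) V) (map (row inc H) V) = card ?X"
  proof (rule edge_count_eq[OF distinct_V])
    show "?Q u v = ?Q v u" for u v
      by (simp add: adjacent_def at_most_above_rows[OF distinct_V] below_meet_row conj_commute)
  qed (simp add: adjacent_def)
  also have "{e. e edge_of P} = (\<lambda>X. convex hull (p ` X)) ` ?X"
  proof -
    have "e edge_of P \<longleftrightarrow> (\<exists>u\<in>set V. \<exists>v\<in>set V. u \<noteq> v \<and> e = closed_segment (p u) (p v) \<and> e face_of P)" for e
      unfolding edge_iff_segment[OF polytope_P] vertices_P by (simp add: image_iff) (metis p_eq_iff)
    then have "e edge_of P \<longleftrightarrow> (\<exists>u\<in>set V. \<exists>v\<in>set V. u \<noteq> v \<and> e = closed_segment (p u) (p v) \<and> ?Q u v)" for e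
      using adjacent_iff by (metis (no_types))
    moreover have "(\<exists>X\<in>?X. R X) \<longleftrightarrow> (\<exists>u\<in>set V. \<exists>v\<in>set V. u \<noteq> v \<and> R {u, v} \<and> ?Q u v)" for R
      by blast
    ultimately have "e edge_of P \<longleftrightarrow> (\<exists>X\<in>?X. e = convex hull (p ` X))" for e
      by (simp add: segment_convex_hull)
    then show ?thesis unfolding image_def by (rule Collect_cong)
  qed
  moreover have "inj_on (\<lambda>X. convex hull (p ` X)) ?X"
  proof (rule inj_onI)
    fix X Y assume "X \<in> ?X" "Y \<in> ?X" and eq: "convex hull (p ` X) = convex hull (p ` Y)"
    then obtain u v u' v' where *: "X = {u, v}" "Y = {u', v'}" by blast
    then have "closed_segment (p u) (p v) = closed_segment (p u') (p v')" using eq by (simp add: segment_convex_hull)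
    then show "X = Y" using * by (auto simp: doubleton_eq_iff)
  qed
  ultimately show ?thesis by (simp add: card_image)
qed

text \<open>Here \<open>g\<close> is a deformation map minus a multiple of the identity, so an edge
  scaled by that multiple is one whose ends have equal values under \<open>g\<close>; edge
  coefficients of \<open>g\<close> may be negative. In a triangle, the other two sides force one
  vector to be a multiple of two independent directions, hence zero. In a parallelogram, going
  around from \<open>u\<close> to \<open>v\<close> gives such an equation between the directions
  \<open>z - w\<close> and \<open>z - u\<close>.\<close>

lemma forced_by_sound:
  fixes g :: "'a \<Rightarrow> 'a"
  assumes g: "\<And>u v. u \<in> vertices P \<Longrightarrow> v \<in> vertices P \<Longrightarrow> closed_segment u v face_of P \<Longrightarrow>
      \<exists>l. g u - g v = l *\<^sub>R (u - v)"
    and E: "\<forall>(u, v)\<in>set E. u \<in> set V \<and> v \<in> set V \<and> u \<noteq> v \<and> g (p u) = g (p v)"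
    and zw: "z \<in> set V" "w \<in> set V" and "forced_by inc H (map (row inc H) V) E z w"
  shows "z \<noteq> w \<and> g (p z) = g (p w)"
proof -
  let ?R = "map (row inc H) V"
  have edge: "\<exists>l. g (p x) - g (p y) = l *\<^sub>R (p x - p y)"
    if "x \<in> set V" "y \<in> set V" "x \<noteq> y" "adjacent inc H ?R x y" for x y
    using g[of "p x" "p y"] that adjacent_iff vertices_P by auto
  have indep: "a = 0 \<and> b = 0"
    if "x \<in> set V" "y \<in> set V" "t \<in> set V" "x \<noteq> y" "x \<noteq> t" "y \<noteq> t" "a *\<^sub>R (p x - p y) = b *\<^sub>R (p x - p t)"
    for x y t a b
    using vertices_independent[of "p x" P "p y" "p t" a b] that vertices_P by auto
  have "\<exists>(u, v)\<in>set E. forces inc H ?R u v z w"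
    using assms(5) by (induction E) (auto split: if_splits)
  then obtain u v where uv: "(u, v) \<in> set E" and "forces inc H ?R u v z w" by blast
  then consider (triangle) "w = u \<or> w = v" "z \<noteq> u" "z \<noteq> v" "adjacent inc H ?R u z" "adjacent inc H ?R v z"
    | (parallelogram) "w \<noteq> u" "w \<noteq> v" "z - u = w - v" "z \<noteq> u" "z \<noteq> w"
      "adjacent inc H ?R u z" "adjacent inc H ?R v w" "adjacent inc H ?R z w"
    unfolding forces_def by (metis (full_types))
  moreover from uv E have V: "u \<in> set V" "v \<in> set V" "u \<noteq> v" "g (p u) = g (p v)" by auto
  ultimately show ?thesis
  proof cases
    case triangle
    then obtain a b where "g (p u) - g (p z) = a *\<^sub>R (p u - p z)" "g (p v) - g (p z) = b *\<^sub>R (p v - p z)"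
      using edge V zw by metis
    then have ab: "g (p u) - g (p z) = a *\<^sub>R (p u - p z)" "a *\<^sub>R (p z - p u) = b *\<^sub>R (p z - p v)"
      using V(4) by (metis minus_diff_eq scaleR_minus_right)+
    then have "a = 0" using indep[of z u v a b] V zw triangle by blast
    then show ?thesis using ab(1) triangle V(4) by auto
  next
    case parallelogram
    then obtain a b c where abc: "g (p u) - g (p z) = a *\<^sub>R (p u - p z)" "g (p v) - g (p w) = b *\<^sub>R (p v - p w)"
      "g (p z) - g (p w) = c *\<^sub>R (p z - p w)"
      using edge V zw by metis
    have pvw: "p v - p w = p u - p z" using p_diff[OF parallelogram(3)] by (metis minus_diff_eq)
    have "g (p z) - g (p w) = (g (p v) - g (p w)) - (g (p u) - g (p z))" using V(4) by simp
    then have "g (p z) - g (p w) = b *\<^sub>R (p u - p z) - a *\<^sub>R (p u - p z)"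
      by (simp only: abc(1,2) pvw)
    then have "c *\<^sub>R (p z - p w) = (a - b) *\<^sub>R (p z - p u)"
      using abc(3) by (simp add: algebra_simps)
    then have "c = 0" using indep[of z w u c "a - b"] V zw parallelogram by blast
    then show ?thesis using abc(3) parallelogram by simp
  qed
qed

lemma forced_order_sound:
  fixes g :: "'a \<Rightarrow> 'a"
  assumes g: "\<And>u v. u \<in> vertices P \<Longrightarrow> v \<in> vertices P \<Longrightarrow> closed_segment u v face_of P \<Longrightarrow>
      \<exists>l. g u - g v = l *\<^sub>R (u - v)"
    and "\<forall>(u, v)\<in>set E. u \<in> set V \<and> v \<in> set V \<and> u \<noteq> v \<and> g (p u) = g (p v)"
    and "\<forall>(u, v)\<in>set es. u \<in> set V \<and> v \<in> set V" and "forced_order inc H (map (row inc H) V) E es"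
  shows "\<forall>(u, v)\<in>set es. g (p u) = g (p v)"
  using assms(2-4)
proof (induction es arbitrary: E)
  case (Cons e es)
  obtain z w where e: "e = (z, w)" by force
  have "z \<noteq> w \<and> g (p z) = g (p w)"
    using forced_by_sound[OF g Cons.prems(1), of z w] Cons.prems(2,3) by (auto simp: e split: if_splits)
  then show ?case using Cons.IH[of "e # E"] Cons.prems by (auto simp: e split: if_splits)
qed simp

lemma spanning_sound:
  assumes "\<forall>(u, v)\<in>set E. f u = f v" "\<forall>x\<in>set seen. f x = c" "spanning E seen vs"
  shows "\<forall>v\<in>set vs. f v = c"
  using assms(2,3)
proof (induction vs arbitrary: seen)
  case (Cons v vs)
  then obtain x y where "(x, y) \<in> set E" "x = v \<and> y \<in> set seen \<or> y = v \<and> x \<in> set seen"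
    by (auto simp: list_ex_iff split: if_splits)
  then have "f v = c" using assms(1) Cons.prems(1) by auto
  have seen: "\<forall>x\<in>set (v # seen). f x = c" using \<open>f v = c\<close> Cons.prems(1) by auto
  have "spanning E (v # seen) vs" using Cons.prems(2) by (simp split: if_splits)
  with seen have "\<forall>v\<in>set vs. f v = c" by (rule Cons.IH)
  with \<open>f v = c\<close> show ?case by simp
qed simp

lemma indecomposable:
  assumes "rigid_check inc H (map (row inc H) V) V es"
  shows "indecomposable P"
proof (rule indecomposableI_vertex_map[OF polytope_P])
  show "P \<noteq> {}" using dim_P_facets by auto
  fix q :: "'a \<Rightarrow> 'a"
  assume q: "\<And>u v. u \<in> vertices P \<Longrightarrow> v \<in> vertices P \<Longrightarrow> closed_segment u v face_of P \<Longrightarrow>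
    \<exists>l\<ge>0. q u - q v = l *\<^sub>R (u - v)"
  obtain e es' where "es = e # es'" using assms by (cases es) (auto simp: rigid_check_def)
  then obtain u0 v0 where es1: "es = (u0, v0) # es'" by (cases e) auto
  have "list_all (\<lambda>(x, y). List.member V x \<and> List.member V y) es"
    using assms unfolding rigid_check_def by (simp only: es1 list.case prod.case)
  then have es2: "\<forall>(x, y)\<in>set es. x \<in> set V \<and> y \<in> set V"
    unfolding list_all_iff by auto
  have es: "es = (u0, v0) # es'" "u0 \<noteq> v0" "adjacent inc H (map (row inc H) V) u0 v0"
      "forced_order inc H (map (row inc H) V) [(u0, v0)] es'"
      "\<forall>(x, y)\<in>set es. x \<in> set V \<and> y \<in> set V" "spanning es [hd V] (tl V)"
    using assms es2 unfolding rigid_check_def by (simp_all only: es1 list.case prod.case simp_thms)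
  have uv: "u0 \<in> set V" "v0 \<in> set V" using es by auto
  then obtain l where l: "l \<ge> 0" "q (p u0) - q (p v0) = l *\<^sub>R (p u0 - p v0)"
    using q[of "p u0" "p v0"] adjacent_iff[OF uv es(2)] es(3) vertices_P by auto
  \<comment> \<open>The first edge fixes the candidate factor \<open>l\<close>. After subtracting
    this homothety it remains to show that \<open>g\<close> is constant on the vertices, and the
    constant is the translation.\<close>
  define g where "g x = q x - l *\<^sub>R x" for x
  have g0: "g (p u0) = g (p v0)" using l(2) by (simp add: g_def algebra_simps)
  have "\<exists>m. g u - g v = m *\<^sub>R (u - v)"
    if "u \<in> vertices P" "v \<in> vertices P" "closed_segment u v face_of P" for u v
  proof -
    have "\<exists>m\<ge>0. q u - q v = m *\<^sub>R (u - v)" using q[OF that] .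
    then obtain m where "q u - q v = m *\<^sub>R (u - v)" by blast
    then have "g u - g v = (m - l) *\<^sub>R (u - v)" by (simp add: g_def algebra_simps)
    then show ?thesis by blast
  qed
  then have "\<forall>(u, v)\<in>set es'. g (p u) = g (p v)"
    using es uv g0 by (intro forced_order_sound[of g "[(u0, v0)]"]) auto
  then have es_g: "\<forall>(u, v)\<in>set es. g (p u) = g (p v)" using g0 es(1) by simp
  have "\<forall>x\<in>set [hd V]. g (p x) = g (p (hd V))" by simp
  with es_g have "\<forall>v\<in>set (tl V). g (p v) = g (p (hd V))" using es(6) by (rule spanning_sound)
  then have "\<forall>v\<in>set V. g (p v) = g (p (hd V))" by (cases V) auto
  then have "\<forall>v\<in>vertices P. q v = l *\<^sub>R v + g (p (hd V))"
    unfolding vertices_P by (auto simp: g_def algebra_simps)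
  then show "\<exists>l\<ge>0. \<exists>t. \<forall>v\<in>vertices P. q v = l *\<^sub>R v + t" using l(1) by blast
qed

end

section \<open>Finding the vertices among generating points\<close>

definition extremal :: "('h \<Rightarrow> 'p \<Rightarrow> bool) \<Rightarrow> 'h list \<Rightarrow> bits list \<Rightarrow> 'p list \<Rightarrow> 'p list" where
  "extremal inc H R W = filter (\<lambda>v. at_most_above (Suc 0) (row inc H v) R) W"

lemma set_extremal:
  assumes "distinct W"
  shows "set (extremal inc H (map (row inc H) W) W) =
    {v \<in> set W. \<forall>w\<in>set W. (\<forall>h\<in>set H. inc h v \<longrightarrow> inc h w) \<longrightarrow> w = v}"
proof -
  have "card {w \<in> set W. \<forall>h\<in>set H. inc h v \<longrightarrow> inc h w} \<le> Suc 0 \<longleftrightarrow>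
      (\<forall>w\<in>set W. (\<forall>h\<in>set H. inc h v \<longrightarrow> inc h w) \<longrightarrow> w = v)" if "v \<in> set W" for v
    using that by (subst card_le_Suc0_iff_eq) auto
  then show ?thesis
    by (auto simp: extremal_def at_most_above_rows[OF assms] below_row)
qed

context halfspace_polytope
begin

text \<open>The inequalities tight at \<open>p v\<close> cut out the smallest face containing
  \<open>p v\<close>, and \<open>p v\<close> is a vertex exactly when this face contains no other
  generator.\<close>

lemma vertices_eq_extremal:
  assumes P: "P = convex hull (p ` W)" and inj: "inj p"
    and s_p_eq_0_iff: "\<And>h v. h \<in> H \<Longrightarrow> s h (p v) = 0 \<longleftrightarrow> inc h v"
  shows "vertices P = p ` {v \<in> W. \<forall>w\<in>W. (\<forall>h\<in>H. inc h v \<longrightarrow> inc h w) \<longrightarrow> w = v}"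
proof -
  have W: "p w \<in> P" if "w \<in> W" for w using that unfolding P by (simp add: hull_inc)
  have vW: "\<exists>v\<in>W. x = p v" if "x \<in> vertices P" for x
  proof -
    have "x extreme_point_of (convex hull (p ` W))" using that unfolding P by simp
    then show ?thesis using extreme_point_of_convex_hull by blast
  qed
  show ?thesis
  proof (intro equalityI subsetI)
    fix x assume x: "x \<in> vertices P"
    then obtain v where v: "v \<in> W" "x = p v" using vW by blast
    have "{p v} face_of P" using x v by (simp add: face_of_singleton)
    then obtain S where S: "S \<subseteq> H" "{p v} = tight S" using face_eq_tight by blast
    have "w = v" if w: "w \<in> W" "\<forall>h\<in>H. inc h v \<longrightarrow> inc h w" for w
    proof -
      have "p v \<in> tight S" using S(2) by blast
      have "s h (p w) = 0" if h: "h \<in> S" for h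
      proof -
        have "s h (p v) = 0" using \<open>p v \<in> tight S\<close> h by (simp add: tight_def)
        then show ?thesis using s_p_eq_0_iff[of h] w(2) S(1) h by blast
      qed
      then have "p w \<in> tight S" using W[OF w(1)] by (simp add: tight_def)
      then have "p w = p v" using S(2) by blast
      then show ?thesis using inj by (simp add: inj_eq)
    qed
    then show "x \<in> p ` {v \<in> W. \<forall>w\<in>W. (\<forall>h\<in>H. inc h v \<longrightarrow> inc h w) \<longrightarrow> w = v}"
      using v by blast
  next
    fix x assume "x \<in> p ` {v \<in> W. \<forall>w\<in>W. (\<forall>h\<in>H. inc h v \<longrightarrow> inc h w) \<longrightarrow> w = v}"
    then obtain v where v: "x = p v" "v \<in> W" "\<forall>w\<in>W. (\<forall>h\<in>H. inc h v \<longrightarrow> inc h w) \<longrightarrow> w = v"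
      by blast
    define S where "S = {h \<in> H. inc h v}"
    have S: "S \<subseteq> H" by (auto simp: S_def)
    have pv: "p v \<in> tight S" using W[OF v(2)] s_p_eq_0_iff by (auto simp: tight_def S_def)
    have "y = p v" if y: "y \<in> vertices P" "y \<in> tight S" for y
    proof -
      obtain w where w: "w \<in> W" "y = p w" using vW y by blast
      have "\<forall>h\<in>H. inc h v \<longrightarrow> inc h w" using y(2) s_p_eq_0_iff w(2) by (auto simp: tight_def S_def)
      then show ?thesis using v(3) w by blast
    qed
    then have sub: "vertices P \<inter> tight S \<subseteq> {p v}" by blast
    have eq: "tight S = convex hull (vertices P \<inter> tight S)"
      using face_eq_hull_vertices[OF polytope_P tight_face_of[OF S]] .
    \<comment> \<open>A nonempty face has a vertex, and \<open>p v\<close> is the only candidate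
      left.\<close>
    then have "vertices P \<inter> tight S \<noteq> {}" using pv by force
    then have "p v \<in> vertices P" using sub by blast
    then show "x \<in> vertices P" using v(1) by simp
  qed
qed

end

subsection \<open>Integer coordinates on a hyperplane\<close>

type_synonym point = "int \<times> int \<times> int \<times> int"
type_synonym functional = "int \<times> int \<times> int \<times> int \<times> int"

fun slack :: "functional \<Rightarrow> point \<Rightarrow> int" where
  "slack (k, a, b, c, d) (x, y, z, w) = k + a * x + b * y + c * z + d * w"

definition vanishes :: "functional \<Rightarrow> point \<Rightarrow> bool" where
  "vanishes h v \<longleftrightarrow> slack h v = 0"

text \<open>Each segment contributes 1 to the coordinate sum, so the polytopes lie where the sum is
  \<open>N = nm\<close>. The coordinate at \<open>k0\<close> is recovered from this equation, which
  leaves four integers to compute with.\<close>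

locale coordinates =
  fixes k0 k1 k2 k3 k4 :: "'n::finite" and N :: int
  assumes UNIV_coords: "UNIV = {k0, k1, k2, k3, k4}" and distinct_coords: "distinct [k0, k1, k2, k3, k4]"
begin

definition lin :: "functional \<Rightarrow> real ^ 'n \<Rightarrow> real" where
  "lin h x = (case h of (k, a, b, c, d) \<Rightarrow>
     of_int k + of_int a * x $ k1 + of_int b * x $ k2 + of_int c * x $ k3 + of_int d * x $ k4)"

definition point :: "point \<Rightarrow> real ^ 'n" where
  "point v = (case v of (x, y, z, w) \<Rightarrow>
     \<chi> i. if i = k1 then of_int x else if i = k2 then of_int y else if i = k3 then of_int z
       else if i = k4 then of_int w else of_int (N - x - y - z - w))"

definition hyperplane :: "(real ^ 'n) set" where
  "hyperplane = {x. (\<Sum>i\<in>UNIV. x $ i) = of_int N}"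

lemma sum_coords: "(\<Sum>i\<in>UNIV. f i) = f k0 + f k1 + f k2 + f k3 + (f k4 :: real)"
  using distinct_coords by (simp add: UNIV_coords)

lemma all_coords: "(\<forall>i. Q i) \<longleftrightarrow> Q k0 \<and> Q k1 \<and> Q k2 \<and> Q k3 \<and> Q k4"
  using UNIV_coords by (metis UNIV_I empty_iff insert_iff)

lemma point_nth:
  "point (x, y, z, w) $ k0 = of_int (N - x - y - z - w)"
  "point (x, y, z, w) $ k1 = of_int x" "point (x, y, z, w) $ k2 = of_int y"
  "point (x, y, z, w) $ k3 = of_int z" "point (x, y, z, w) $ k4 = of_int w"
  using distinct_coords by (auto simp: point_def)

lemma lin_point: "lin h (point v) = of_int (slack h v)"
  by (cases h; cases v) (simp add: lin_def point_nth)

lemma point_in_hyperplane: "point v \<in> hyperplane"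
  by (cases v) (simp add: hyperplane_def sum_coords point_nth)

lemma inj_point: "inj point"
proof (rule injI)
  fix u v assume eq: "point u = point v"
  obtain x y z w x' y' z' w' where "u = (x, y, z, w)" "v = (x', y', z', w')"
    by (cases u; cases v) auto
  moreover have "point u $ k = point v $ k" for k using eq by simp
  note this[of k1] this[of k2] this[of k3] this[of k4]
  ultimately show "u = v" by (simp add: point_nth)
qed

lemma point_diff:
  assumes "z - u = w - v"
  shows "point z - point u = point w - point v"
proof -
  obtain z1 z2 z3 z4 u1 u2 u3 u4 w1 w2 w3 w4 v1 v2 v3 v4 where
    eqs: "z = (z1, z2, z3, z4)" "u = (u1, u2, u3, u4)" "w = (w1, w2, w3, w4)" "v = (v1, v2, v3, v4)"
    by (cases z; cases u; cases w; cases v) auto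
  have "real_of_int z1 - of_int u1 = of_int w1 - of_int v1" "real_of_int z2 - of_int u2 = of_int w2 - of_int v2"
    "real_of_int z3 - of_int u3 = of_int w3 - of_int v3" "real_of_int z4 - of_int u4 = of_int w4 - of_int v4"
    using assms unfolding eqs of_int_diff[symmetric] of_int_eq_iff by simp_all
  then show ?thesis
    unfolding vec_eq_iff all_coords eqs by (simp add: point_nth)
qed

lemma affine_coordinate_hyperplane: "affine hyperplane"
  by (auto simp: affine_def hyperplane_def sum.distrib sum_distrib_left[symmetric] algebra_simps)
    (metis distrib_right mult_1 of_int_mult)

lemma lin_affine: "lin h ((1 - t) *\<^sub>R x + t *\<^sub>R y) = (1 - t) * lin h x + t * lin h y"
  by (cases h) (simp add: lin_def algebra_simps)

lemma aff_dim_subset_hyperplane: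
  assumes "P \<subseteq> hyperplane"
  shows "aff_dim P \<le> 4"
proof -
  have "hyperplane = {x. (\<Sum>i\<in>UNIV. axis i 1) \<bullet> x = of_int N}"
    by (simp add: hyperplane_def inner_sum_left inner_axis')
  moreover have "(\<Sum>i\<in>UNIV. axis i 1) \<noteq> (0 :: real ^ 'n)"
  proof
    assume "(\<Sum>i\<in>UNIV. axis i 1) = (0 :: real ^ 'n)"
    then have "(\<Sum>i\<in>UNIV. axis i 1) \<bullet> (axis k0 1 :: real ^ 'n) = 0" by simp
    then show False by (simp add: inner_sum_left inner_axis_axis)
  qed
  moreover have "DIM(real ^ 'n) = 5" using distinct_coords by (simp add: UNIV_coords)
  ultimately have "aff_dim hyperplane = 4" using aff_dim_hyperplane by fastforce
  then show ?thesis using aff_dim_subset[OF assms] by simp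
qed

text \<open>The generators \<open>W\<close> may include points that are not vertices. Nonnegative
  slacks put their hull inside \<open>P\<close>, the assumption \<open>hull\<close> gives the
  converse, and this equality is what shows that the inequalities bound a polytope.\<close>

lemma incidence_modelI:
  assumes P: "P = {x \<in> hyperplane. \<forall>h\<in>set H. 0 \<le> lin h x}"
    and hull: "P \<subseteq> convex hull (point ` set W)"
    and W: "list_all (\<lambda>w. list_all (\<lambda>h. 0 \<le> slack h w) H) W" "distinct W"
    and V: "extremal vanishes H (map (row vanishes H) W) W = V"
    and ok: "facets_ok vanishes H V"
  shows "incidence_model P hyperplane H lin point V vanishes"
proof -
  have "0 \<le> lin h (point w)" if "h \<in> set H" "w \<in> set W" for h w
    unfolding lin_point using W(1) that by (simp add: list_all_iff)
  then have "point ` set W \<subseteq> P"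
    unfolding P using point_in_hyperplane by blast
  moreover have "convex P"
    unfolding P convex_alt
  proof (intro ballI allI impI)
    fix x y and t :: real
    assume "x \<in> {x \<in> hyperplane. \<forall>h\<in>set H. 0 \<le> lin h x}"
      "y \<in> {x \<in> hyperplane. \<forall>h\<in>set H. 0 \<le> lin h x}" "0 \<le> t \<and> t \<le> 1"
    then show "(1 - t) *\<^sub>R x + t *\<^sub>R y \<in> {x \<in> hyperplane. \<forall>h\<in>set H. 0 \<le> lin h x}"
      using mem_affine[OF affine_coordinate_hyperplane, of x y "1 - t" t] by (simp add: lin_affine)
  qed
  ultimately have hull_eq: "P = convex hull (point ` set W)"
    using hull by (intro equalityI hull_minimal)
  then have "polytope P" unfolding polytope_def by (metis finite_imageI finite_set)
  then interpret halfspace_polytope P hyperplane "set H" lin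
    by unfold_locales (auto simp: P affine_coordinate_hyperplane lin_affine)
  have zero: "lin h (point v) = 0 \<longleftrightarrow> vanishes h v" for h v
    by (simp add: lin_point vanishes_def)
  have "vertices P = point ` set V"
    using vertices_eq_extremal[OF hull_eq inj_point, of vanishes] zero
    by (simp add: set_extremal[OF W(2)] flip: V)
  moreover have "distinct V" using W(2) V by (auto simp: extremal_def)
  moreover have "aff_dim P \<le> 4" by (rule aff_dim_subset_hyperplane) (auto simp: P)
  ultimately show ?thesis
  proof unfold_locales
    show "lin h (point v) = 0 \<longleftrightarrow> vanishes h v" for h v by (rule zero)
    show "inj point" by (rule inj_point)
    show "point z - point u = point w - point v" if "z - u = w - v" for u v z w
      using that by (rule point_diff)
    show "facets_ok vanishes H V" by (rule ok)
  qed
qed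

end

subsection \<open>The cut zonotope as a projection of a truncated cube\<close>

definition integral_at :: "real ^ 'k \<Rightarrow> 'k \<Rightarrow> bool" where
  "integral_at t k \<longleftrightarrow> t $ k = 0 \<or> t $ k = 1"

text \<open>Two fractional coordinates can be traded against each other, in both directions and without
  changing the sum, until one of them becomes integral.  A single fractional coordinate can be rounded
  both ways, because an integral bound on the sum is then not attained.\<close>

lemma truncated_cube_subset_hull:
  fixes t :: "real ^ 'k::finite"
  assumes "\<forall>k. 0 \<le> t $ k \<and> t $ k \<le> 1" "(\<Sum>k\<in>UNIV. t $ k) \<le> real CARD('k) - 1"
  shows "t \<in> convex hull {s. (\<forall>k. integral_at s k) \<and> (\<exists>k. s $ k = 0)}"
  using assms
proof (induction "card {k. \<not> integral_at t k}" arbitrary: t rule: less_induct)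
  case less
  let ?C = "convex hull {s :: real ^ 'k. (\<forall>k. integral_at s k) \<and> (\<exists>k. s $ k = 0)}"
  define upd where "upd a x b y = (\<chi> k. if k = a then x else if k = b then y else t $ k)" for a x b y
  have sum_upd: "(\<Sum>k\<in>UNIV. upd a x b y $ k) = (\<Sum>k\<in>UNIV. t $ k) + (x - t $ a) + (y - t $ b)"
    if "a \<noteq> b" for a x b y
  proof -
    have "(\<Sum>k\<in>UNIV. upd a x b y $ k) - (\<Sum>k\<in>UNIV. t $ k) =
        (\<Sum>k\<in>UNIV. (if k = a then x - t $ a else 0) + (if k = b then y - t $ b else 0))"
      unfolding sum_subtractf[symmetric] using that by (intro sum.cong) (auto simp: upd_def)
    also have "\<dots> = (x - t $ a) + (y - t $ b)" by (simp add: sum.distrib)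
    finally show ?thesis by simp
  qed
  have IH: "upd a x b y \<in> ?C"
    if "a \<noteq> b" "\<not> integral_at t a" "\<not> integral_at t b" "x + y = t $ a + t $ b"
      "0 \<le> x" "x \<le> 1" "0 \<le> y" "y \<le> 1" "x \<in> {0, 1} \<or> y \<in> {0, 1}" for a x b y
  proof (rule less.hyps)
    have "integral_at (upd a x b y) k" if "integral_at t k" for k
    proof -
      have "k \<noteq> a" "k \<noteq> b" using that \<open>\<not> integral_at t a\<close> \<open>\<not> integral_at t b\<close> by auto
      then show ?thesis using that by (simp add: integral_at_def upd_def)
    qed
    moreover have "integral_at (upd a x b y) a \<or> integral_at (upd a x b y) b"
      using that(1,9) by (auto simp: integral_at_def upd_def)
    ultimately have "{k. \<not> integral_at (upd a x b y) k} \<subset> {k. \<not> integral_at t k}"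
      using that(2,3) by blast
    then show "card {k. \<not> integral_at (upd a x b y) k} < card {k. \<not> integral_at t k}"
      by (intro psubset_card_mono) auto
    show "\<forall>k. 0 \<le> upd a x b y $ k \<and> upd a x b y $ k \<le> 1"
      using that less.prems(1) by (simp add: upd_def)
    show "(\<Sum>k\<in>UNIV. upd a x b y $ k) \<le> real CARD('k) - 1"
      using less.prems(2) that sum_upd by simp
  qed
  have between: "t \<in> ?C"
    if "p \<in> ?C" "q \<in> ?C" "0 \<le> u" "u \<le> 1" "t = (1 - u) *\<^sub>R p + u *\<^sub>R q" for p q u
    using that convexD_alt[OF convex_convex_hull that(1,2,3,4)] by simp
  have int_sum: "\<exists>n::int. (\<Sum>k\<in>UNIV. s $ k) = of_int n" if "\<forall>k. integral_at s k" for s :: "real ^ 'k"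
  proof -
    have "s $ k \<in> \<int>" for k using that[rule_format, of k] by (auto simp: integral_at_def)
    then have "(\<Sum>k\<in>UNIV. s $ k) \<in> \<int>" by (intro Ints_sum)
    then show ?thesis by (auto elim: Ints_cases)
  qed
  consider (none) "\<forall>k. integral_at t k"
    | (one) a where "\<not> integral_at t a" "\<forall>k. k \<noteq> a \<longrightarrow> integral_at t k"
    | (two) a b where "a \<noteq> b" "\<not> integral_at t a" "\<not> integral_at t b" by blast
  then show ?case
  proof cases
    case none
    have "\<exists>k. t $ k = 0"
    proof (rule ccontr)
      assume "\<nexists>k. t $ k = 0"
      then have "\<forall>k. t $ k = 1" using none by (auto simp: integral_at_def)
      then show False using less.prems(2) by simp
    qed
    then show ?thesis using none by (intro hull_inc) auto
  next
    case (one a)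
    then have a: "0 < t $ a" "t $ a < 1" using less.prems(1) by (auto simp: integral_at_def less_le)
    define s where "s x = (\<chi> k. if k = a then x else t $ k)" for x
    have s01: "\<forall>k. integral_at (s x) k" if "x = 0 \<or> x = 1" for x
      using one that by (auto simp: s_def integral_at_def)
    have sum_s: "(\<Sum>k\<in>UNIV. s x $ k) = (\<Sum>k\<in>UNIV. t $ k) + (x - t $ a)" for x
    proof -
      have "(\<Sum>k\<in>UNIV. s x $ k) - (\<Sum>k\<in>UNIV. t $ k) = (\<Sum>k\<in>UNIV. (if k = a then x - t $ a else 0))"
        unfolding sum_subtractf[symmetric] by (intro sum.cong) (auto simp: s_def)
      then show ?thesis by simp
    qed
    \<comment> \<open>The integer sum of \<open>s 0\<close> is strictly below the integer
      \<open>CARD('k) - 1\<close>, so rounding up gives a sum below \<open>CARD('k)\<close> and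
      cannot produce the all-ones vector.\<close>
    obtain n :: int where n: "(\<Sum>k\<in>UNIV. s 0 $ k) = of_int n" using int_sum s01 by blast
    then have "of_int n < real CARD('k) - 1" using sum_s[of 0] less.prems(2) a by linarith
    then have "real_of_int n < of_int (int CARD('k) - 1)" by simp
    then have "n < int CARD('k) - 1" by (simp only: of_int_less_iff)
    then have "n + 1 < int CARD('k)" by simp
    then have "real_of_int (n + 1) < of_int (int CARD('k))" by (simp only: of_int_less_iff)
    then have less1: "(\<Sum>k\<in>UNIV. s 1 $ k) < real CARD('k)" using n sum_s[of 0] sum_s[of 1] by simp
    have "\<exists>k. s 1 $ k = 0"
    proof (rule ccontr)
      assume "\<nexists>k. s 1 $ k = 0"
      then have "\<forall>k. s 1 $ k = 1" using s01[of 1] by (auto simp: integral_at_def)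
      then show False using less1 by simp
    qed
    then have "s 1 \<in> ?C" using s01[of 1] by (intro hull_inc) auto
    moreover have "s 0 \<in> ?C"
      using s01[of 0] by (intro hull_inc CollectI conjI exI[of _ a]) (auto simp: s_def)
    moreover have "t = (1 - t $ a) *\<^sub>R s 0 + t $ a *\<^sub>R s 1"
      by (auto simp: vec_eq_iff s_def algebra_simps)
    ultimately show ?thesis using between a by (meson less_imp_le)
  next
    case (two a b)
    define \<sigma> where "\<sigma> = t $ a + t $ b"
    have ab: "0 < t $ a" "t $ a < 1" "0 < t $ b" "t $ b < 1"
      using less.prems(1) two by (auto simp: integral_at_def less_le)
    \<comment> \<open>The extreme values of coordinate \<open>a\<close> for which it and its
      partner, their sum being \<sigma>, both stay in the unit interval; at each extreme one of the
      two is 0 or 1.\<close>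
    define lo where "lo = max 0 (\<sigma> - 1)"
    define hi where "hi = min 1 \<sigma>"
    have lohi: "lo < t $ a" "t $ a < hi" "0 \<le> lo" "hi \<le> 1" "\<sigma> - lo \<le> 1" "0 \<le> \<sigma> - hi"
      "lo \<le> 1" "0 \<le> hi" "0 \<le> \<sigma> - lo" "\<sigma> - hi \<le> 1"
      "lo \<in> {0, 1} \<or> \<sigma> - lo \<in> {0, 1}" "hi \<in> {0, 1} \<or> \<sigma> - hi \<in> {0, 1}"
      using ab by (auto simp: lo_def hi_def \<sigma>_def max_def min_def)
    define p q where "p = upd a lo b (\<sigma> - lo)" and "q = upd a hi b (\<sigma> - hi)"
    have "p \<in> ?C" "q \<in> ?C"
      unfolding p_def q_def by (rule IH; use two lohi in \<open>simp add: \<sigma>_def\<close>)+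
    moreover define u where "u = (t $ a - lo) / (hi - lo)"
    have u: "0 \<le> u" "u \<le> 1" "u * (hi - lo) = t $ a - lo"
      using lohi by (auto simp: u_def divide_simps)
    have "(1 - u) * lo + u * hi = t $ a" using u(3) by (simp add: algebra_simps)
    moreover from this have "(1 - u) * (\<sigma> - lo) + u * (\<sigma> - hi) = t $ b"
      by (simp add: \<sigma>_def algebra_simps)
    ultimately have "t = (1 - u) *\<^sub>R p + u *\<^sub>R q"
      using two(1) by (auto simp: vec_eq_iff p_def q_def upd_def algebra_simps)
    with \<open>p \<in> ?C\<close> \<open>q \<in> ?C\<close> u show ?thesis using between by blast
  qed
qed

text \<open>\<open>t $ (i, j)\<close> is the position on the segment from the \<open>i\<close>-th
  \<open>a\<close>-vector to the \<open>j\<close>-th \<open>b\<close>-vector. A 0-1 vector is an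
  orientation of the complete bipartite graph, and its image is the vector of in-degrees.\<close>

definition orientation_point :: "real ^ ('n::finite \<times> 'm::finite) \<Rightarrow> real ^ ('n + 'm)" where
  "orientation_point t = (\<chi> k. case k of Inl i \<Rightarrow> (\<Sum>j\<in>UNIV. 1 - t $ (i, j)) | Inr j \<Rightarrow> (\<Sum>i\<in>UNIV. t $ (i, j)))"

lemma orientation_point_eq_sum:
  "orientation_point (\<chi> k. f (fst k) (snd k)) =
    (\<Sum>i\<in>UNIV. \<Sum>j\<in>UNIV. (1 - f i j) *\<^sub>R axis (Inl i) 1 + f i j *\<^sub>R axis (Inr j) (1 :: real))"
proof -
  have "orientation_point (\<chi> k. f (fst k) (snd k)) $ k =
    (\<Sum>i\<in>UNIV. \<Sum>j\<in>UNIV. (1 - f i j) *\<^sub>R axis (Inl i) 1 + f i j *\<^sub>R axis (Inr j) (1 :: real)) $ k" for k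
  proof (cases k)
    case (Inl i)
    have "(\<Sum>a\<in>UNIV. \<Sum>j\<in>UNIV. (1 - f a j) *\<^sub>R axis (Inl a) 1 + f a j *\<^sub>R axis (Inr j) (1 :: real)) $ Inl i
       = (\<Sum>a\<in>UNIV. if a = i then \<Sum>j\<in>UNIV. 1 - f a j else 0)"
      unfolding sum_component by (intro sum.cong) (auto simp: axis_def)
    then show ?thesis by (simp add: Inl orientation_point_def)
  next
    case (Inr j)
    have "(\<Sum>i\<in>UNIV. \<Sum>b\<in>UNIV. (1 - f i b) *\<^sub>R axis (Inl i) 1 + f i b *\<^sub>R axis (Inr b) (1 :: real)) $ Inr j
       = (\<Sum>i\<in>UNIV. \<Sum>b\<in>UNIV. if b = j then f i b else 0)"
      unfolding sum_component by (intro sum.cong) (auto simp: axis_def)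
    then show ?thesis by (simp add: Inr orientation_point_def)
  qed
  then show ?thesis by (simp add: vec_eq_iff)
qed

lemma mem_bipartite_zonotope_iff:
  fixes x :: "real ^ ('n::finite + 'm::finite)"
  shows "x \<in> bipartite_zonotope \<longleftrightarrow> (\<exists>t. (\<forall>k. 0 \<le> t $ k \<and> t $ k \<le> 1) \<and> x = orientation_point t)"
proof
  assume "x \<in> bipartite_zonotope"
  then obtain s where s: "x = sum s UNIV"
    "\<forall>i\<in>UNIV. s i \<in> (\<Sum>j\<in>UNIV. closed_segment (axis (Inl i) 1) (axis (Inr j) (1 :: real)))"
    by (auto simp: bipartite_zonotope_def set_sum_alt)
  then have "\<forall>i. \<exists>r. s i = sum r UNIV \<and> (\<forall>j. r j \<in> closed_segment (axis (Inl i) 1) (axis (Inr j) (1 :: real)))"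
    by (auto simp: set_sum_alt)
  then obtain r where r: "\<And>i. s i = sum (r i) UNIV"
    "\<And>i j. r i j \<in> closed_segment (axis (Inl i) 1) (axis (Inr j) (1 :: real))"
    by metis
  have "\<forall>i j. \<exists>u. 0 \<le> u \<and> u \<le> 1 \<and> r i j = (1 - u) *\<^sub>R axis (Inl i) 1 + u *\<^sub>R axis (Inr j) (1 :: real)"
    using r(2) by (auto simp: in_segment)
  then obtain f where f: "\<And>i j. 0 \<le> f i j \<and> f i j \<le> 1"
    "\<And>i j. r i j = (1 - f i j) *\<^sub>R axis (Inl i) 1 + f i j *\<^sub>R axis (Inr j) (1 :: real)"
    by metis
  have "s i = (\<Sum>j\<in>UNIV. (1 - f i j) *\<^sub>R axis (Inl i) 1 + f i j *\<^sub>R axis (Inr j) (1 :: real))" for i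
    unfolding r(1) by (intro sum.cong refl f(2))
  then have "x = orientation_point (\<chi> k. f (fst k) (snd k))"
    unfolding orientation_point_eq_sum s(1) by (intro sum.cong refl)
  then show "\<exists>t. (\<forall>k. 0 \<le> t $ k \<and> t $ k \<le> 1) \<and> x = orientation_point t"
    using f(1) by (intro exI[of _ "\<chi> k. f (fst k) (snd k)"]) simp
next
  assume "\<exists>t. (\<forall>k. 0 \<le> t $ k \<and> t $ k \<le> 1) \<and> x = orientation_point t"
  then obtain t where t: "\<forall>k. 0 \<le> t $ k \<and> t $ k \<le> 1" "x = orientation_point t" by blast
  have "t = (\<chi> k. t $ (fst k, snd k))" by simp
  then have x: "x = (\<Sum>i\<in>UNIV. \<Sum>j\<in>UNIV. (1 - t $ (i, j)) *\<^sub>R axis (Inl i) 1 + t $ (i, j) *\<^sub>R axis (Inr j) (1 :: real))"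
    using t(2) orientation_point_eq_sum[of "\<lambda>i j. t $ (i, j)"] by simp
  have seg: "(1 - t $ (i, j)) *\<^sub>R axis (Inl i) 1 + t $ (i, j) *\<^sub>R axis (Inr j) (1 :: real)
      \<in> closed_segment (axis (Inl i) 1) (axis (Inr j) (1 :: real))" for i j
    using t(1) by (auto simp: in_segment)
  have "(\<Sum>j\<in>UNIV. (1 - t $ (i, j)) *\<^sub>R axis (Inl i) 1 + t $ (i, j) *\<^sub>R axis (Inr j) (1 :: real))
      \<in> (\<Sum>j\<in>UNIV. closed_segment (axis (Inl i) 1) (axis (Inr j) (1 :: real)))" for i
    unfolding set_sum_alt[OF finite] using seg by blast
  moreover have "(bipartite_zonotope :: (real ^ ('n + 'm)) set) = {sum s UNIV |s. \<forall>i\<in>UNIV. s i \<in>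
      (\<Sum>j\<in>UNIV. closed_segment (axis (Inl i) 1) (axis (Inr j) (1 :: real)))}"
    unfolding bipartite_zonotope_def by (rule set_sum_alt) simp
  ultimately show "x \<in> bipartite_zonotope"
    unfolding x by blast
qed

text \<open>The \<open>b\<close>-coordinates of the image add up to the sum of all entries of
  \<open>t\<close>, so the cut pulls back to a truncation of the cube at its all-ones
  vertex.\<close>

lemma mem_cut_zonotope_iff:
  fixes x :: "real ^ ('n::finite + 'm::finite)"
  shows "x \<in> cut_zonotope \<longleftrightarrow>
    (\<exists>t. (\<forall>k. 0 \<le> t $ k \<and> t $ k \<le> 1) \<and> (\<Sum>k\<in>UNIV. t $ k) \<le> real CARD('n \<times> 'm) - 1 \<and>
      x = orientation_point t)"
proof -
  have sum: "(\<Sum>j\<in>UNIV. orientation_point t $ Inr j) = (\<Sum>k\<in>UNIV. t $ k)" for t :: "real ^ ('n \<times> 'm)"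
  proof -
    have "(\<Sum>j\<in>UNIV. orientation_point t $ Inr j) = (\<Sum>i\<in>UNIV. \<Sum>j\<in>UNIV. t $ (i, j))"
      unfolding orientation_point_def by (simp add: sum.swap[of _ "UNIV :: 'n set"])
    also have "\<dots> = (\<Sum>k\<in>UNIV \<times> UNIV. t $ k)" by (simp add: sum.cartesian_product case_prod_unfold)
    finally show ?thesis by simp
  qed
  show ?thesis
    unfolding cut_zonotope_def mem_bipartite_zonotope_iff Int_iff mem_Collect_eq card_prod of_nat_mult
    using sum by metis
qed

lemma cut_zonotope_subset_hull:
  "cut_zonotope \<subseteq> convex hull
    (orientation_point ` {s :: real ^ ('n::finite \<times> 'm::finite). (\<forall>k. integral_at s k) \<and> (\<exists>k. s $ k = 0)})"
proof
  fix x :: "real ^ ('n + 'm)"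
  let ?S = "{s :: real ^ ('n \<times> 'm). (\<forall>k. integral_at s k) \<and> (\<exists>k. s $ k = 0)}"
  let ?D = "convex hull (orientation_point ` ?S)"
  assume "x \<in> cut_zonotope"
  then obtain t where t: "t \<in> convex hull ?S" "x = orientation_point t"
    unfolding mem_cut_zonotope_iff using truncated_cube_subset_hull by blast
  have affine: "orientation_point ((1 - u) *\<^sub>R a + u *\<^sub>R b) =
      (1 - u) *\<^sub>R orientation_point a + u *\<^sub>R orientation_point b" for u and a b :: "real ^ ('n \<times> 'm)"
  proof -
    have "1 - ((1 - u) * a $ (i, j) + u * b $ (i, j)) =
        (1 - u) * (1 - a $ (i, j)) + u * (1 - b $ (i, j))" for i j
      by (simp add: algebra_simps)
    then show ?thesis
      by (simp add: vec_eq_iff orientation_point_def sum.distrib sum_distrib_left split: sum.split)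
  qed
  have "convex {s. orientation_point s \<in> ?D}"
  proof (subst convex_alt, intro ballI allI impI)
    fix a b and u :: real
    assume "a \<in> {s. orientation_point s \<in> ?D}" "b \<in> {s. orientation_point s \<in> ?D}" "0 \<le> u \<and> u \<le> 1"
    then show "(1 - u) *\<^sub>R a + u *\<^sub>R b \<in> {s. orientation_point s \<in> ?D}"
      unfolding mem_Collect_eq affine by (intro convexD_alt[OF convex_convex_hull]) auto
  qed
  moreover have "?S \<subseteq> {s. orientation_point s \<in> ?D}" by (auto intro: hull_inc)
  ultimately have "convex hull ?S \<subseteq> {s. orientation_point s \<in> ?D}" by (simp add: hull_minimal)
  then show "x \<in> ?D" using t by blast
qed

subsection \<open>The two polytopes\<close>

text \<open>
  Points of \<open>P14\<close> are given by their coordinates \<open>(b\<^sub>1, b\<^sub>2, b\<^sub>3, b\<^sub>4)\<close>, points of \<open>P23\<close> by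
  \<open>(a\<^sub>1, b\<^sub>1, b\<^sub>2, b\<^sub>3)\<close>.  The vertices are ordered such that each of them is joined to an earlier one by
  an edge in the list \<open>E14\<close> or \<open>E23\<close>; the points in \<open>C23\<close> are the images of 0-1 matrices that are not
  vertices.  The middle block of \<open>H23\<close> expresses that the first row sum \<open>3 - a\<^sub>1\<close> of a \<open>2 \<times> 3\<close> matrix
  with entries in \<open>[0, 1]\<close> and column sums \<open>b\<^sub>j\<close> is at least the sum of the \<open>b\<^sub>j - 1\<close> over \<open>j \<in> J\<close> and
  at most \<open>card (- J)\<close> plus the sum of the \<open>b\<^sub>j\<close> over \<open>j \<in> J\<close>, where \<open>(i, j, k)\<close> in the code is the indicator of \<open>J\<close>.
\<close>

definition V14 :: "point list" where
  "V14 =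
    [(0, 0, 1, 0), (0, 0, 0, 0), (0, 1, 0, 0), (0, 1, 1, 0), (1, 1, 1, 0), (1, 1, 0, 0),
     (1, 1, 0, 1), (1, 0, 0, 1), (1, 0, 1, 1), (0, 1, 1, 1), (1, 0, 0, 0), (1, 0, 1, 0),
     (0, 1, 0, 1), (0, 0, 0, 1), (0, 0, 1, 1)]"

definition E14 :: "(point \<times> point) list" where
  "E14 =
    [((0, 0, 1, 0), (0, 0, 0, 0)), ((1, 0, 1, 0), (1, 0, 0, 0)), ((1, 0, 1, 1), (1, 0, 0, 1)),
     ((1, 1, 1, 0), (1, 1, 0, 0)), ((1, 1, 0, 1), (1, 0, 0, 1)), ((0, 1, 1, 0), (0, 1, 0, 0)),
     ((1, 1, 0, 1), (1, 1, 1, 0)), ((0, 0, 1, 1), (0, 0, 0, 1)), ((0, 1, 0, 1), (0, 0, 0, 1)),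
     ((0, 1, 1, 1), (1, 1, 1, 0)), ((1, 1, 0, 0), (1, 0, 0, 0)), ((0, 1, 1, 1), (0, 1, 0, 1)),
     ((0, 1, 0, 0), (0, 0, 0, 0)), ((0, 1, 1, 0), (1, 1, 1, 0))]"

definition H14 :: "functional list" where
  "H14 = [(0, 1, 0, 0, 0), (0, 0, 1, 0, 0), (0, 0, 0, 1, 0), (0, 0, 0, 0, 1),
     (1, -1, 0, 0, 0), (1, 0, -1, 0, 0), (1, 0, 0, -1, 0), (1, 0, 0, 0, -1), (3, -1, -1, -1, -1)]"

definition V23 :: "point list" where
  "V23 =
    [(2, 0, 0, 1), (1, 0, 1, 1), (0, 1, 1, 1), (1, 1, 0, 1), (1, 1, 1, 0), (2, 1, 0, 0),
     (2, 0, 1, 0), (3, 0, 0, 0), (3, 0, 1, 0), (2, 0, 2, 0), (1, 0, 2, 1), (0, 1, 2, 1),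
     (1, 1, 2, 0), (2, 1, 2, 0), (3, 1, 1, 0), (2, 2, 1, 0), (1, 2, 2, 0), (0, 2, 2, 1),
     (1, 2, 2, 1), (2, 2, 1, 1), (2, 2, 0, 1), (1, 2, 1, 2), (0, 2, 1, 2), (1, 2, 0, 2),
     (2, 1, 1, 2), (1, 1, 2, 2), (0, 1, 2, 2), (2, 1, 0, 2), (1, 0, 2, 2), (2, 0, 1, 2),
     (3, 1, 1, 1), (2, 1, 2, 1), (3, 1, 0, 1), (2, 0, 0, 2), (1, 0, 1, 2), (2, 0, 2, 1),
     (3, 0, 1, 1), (2, 2, 0, 0), (1, 2, 1, 0), (0, 2, 1, 1), (1, 2, 0, 1), (0, 1, 1, 2),
     (1, 1, 0, 2), (3, 1, 0, 0), (3, 0, 0, 1)]"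

definition C23 :: "point list" where
  "C23 =
    [(1, 1, 1, 1), (1, 1, 1, 2), (1, 1, 2, 1), (1, 2, 1, 1), (2, 0, 1, 1), (2, 1, 0, 1),
     (2, 1, 1, 0), (2, 1, 1, 1)]"

definition E23 :: "(point \<times> point) list" where
  "E23 =
    [((2, 0, 0, 1), (1, 0, 1, 1)), ((3, 0, 0, 0), (2, 0, 1, 0)), ((1, 1, 0, 1), (0, 1, 1, 1)),
     ((2, 0, 0, 2), (1, 0, 1, 2)), ((2, 1, 0, 0), (1, 1, 1, 0)), ((1, 1, 0, 2), (0, 1, 1, 2)),
     ((1, 2, 0, 1), (0, 2, 1, 1)), ((2, 2, 0, 0), (1, 2, 1, 0)), ((1, 2, 0, 2), (0, 2, 1, 2)),
     ((2, 0, 1, 2), (1, 0, 2, 2)), ((2, 2, 1, 0), (1, 2, 2, 0)), ((1, 2, 1, 2), (0, 2, 1, 2)),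
     ((2, 1, 1, 2), (1, 1, 2, 2)), ((3, 1, 1, 0), (2, 1, 2, 0)), ((3, 0, 1, 1), (2, 0, 2, 1)),
     ((3, 0, 1, 0), (2, 0, 2, 0)), ((1, 2, 2, 1), (0, 2, 2, 1)), ((1, 1, 2, 2), (0, 1, 2, 2)),
     ((2, 2, 1, 1), (1, 2, 2, 1)), ((1, 2, 1, 2), (2, 1, 1, 2)), ((3, 1, 1, 1), (2, 1, 2, 1)),
     ((1, 2, 1, 2), (1, 2, 0, 2)), ((2, 1, 1, 2), (2, 1, 0, 2)), ((1, 2, 2, 0), (0, 2, 2, 1)),
     ((2, 2, 1, 1), (2, 2, 0, 1)), ((1, 0, 2, 2), (1, 1, 2, 2)), ((1, 2, 1, 2), (1, 2, 2, 1)),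
     ((2, 2, 1, 1), (3, 1, 1, 1)), ((3, 1, 1, 1), (3, 1, 0, 1)), ((1, 2, 1, 0), (0, 2, 1, 1)),
     ((1, 1, 2, 0), (0, 1, 2, 1)), ((2, 0, 1, 2), (2, 0, 0, 2)), ((2, 0, 2, 1), (2, 1, 2, 1)),
     ((1, 0, 2, 2), (0, 1, 2, 2)), ((1, 0, 2, 1), (0, 1, 2, 1)), ((2, 2, 1, 0), (2, 2, 0, 0)),
     ((2, 2, 1, 0), (3, 1, 1, 0)), ((1, 0, 1, 2), (0, 1, 1, 2)), ((3, 1, 1, 0), (3, 1, 0, 0)),
     ((1, 1, 1, 0), (0, 1, 1, 1)), ((2, 0, 2, 0), (1, 0, 2, 1)), ((3, 0, 1, 1), (3, 0, 0, 1)),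
     ((2, 0, 2, 0), (2, 1, 2, 0)), ((1, 0, 1, 1), (0, 1, 1, 1)), ((3, 0, 1, 0), (3, 0, 0, 0)),
     ((2, 0, 1, 0), (1, 0, 1, 1))]"

definition H23 :: "functional list" where
  "H23 = [(0, 0, 1, 0, 0), (0, 0, 0, 1, 0), (0, 0, 0, 0, 1), (2, 0, -1, 0, 0), (2, 0, 0, -1, 0), (2, 0, 0, 0, -1)] @
     concat (map (\<lambda>(i, j, k). [(3 + i + j + k, -1, -i, -j, -k), (- i - j - k, 1, i, j, k)])
       (List.product [0, 1] (List.product [0, 1] [0, 1]))) @
     [(5, 0, -1, -1, -1)]"

interpretation coords14: coordinates "Inl 1 :: 1 + 4" "Inr 1" "Inr 2" "Inr 3" "Inr 4" 4
proof
  have "(UNIV :: (1 + 4) set) = Inl ` {1} \<union> Inr ` {1, 2, 3, 4}"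
    unfolding UNIV_sum using num1_eq1 exhaust_4 by blast
  then show "(UNIV :: (1 + 4) set) = {Inl 1, Inr 1, Inr 2, Inr 3, Inr 4}" by auto
qed simp

interpretation coords23: coordinates "Inl 2 :: 2 + 3" "Inl 1" "Inr 1" "Inr 2" "Inr 3" 6
proof
  have "(UNIV :: (2 + 3) set) = Inl ` {1, 2} \<union> Inr ` {1, 2, 3}"
    unfolding UNIV_sum using exhaust_2 exhaust_3 by blast
  then show "(UNIV :: (2 + 3) set) = {Inl 2, Inl 1, Inr 1, Inr 2, Inr 3}" by auto
qed simp

lemma pairs14: "(UNIV :: (1 \<times> 4) set) = {(1, 1), (1, 2), (1, 3), (1, 4)}"
  unfolding UNIV_Times_UNIV[symmetric] UNIV_4 by (auto simp: num1_eq1)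

lemma pairs23: "(UNIV :: (2 \<times> 3) set) = {(1, 1), (1, 2), (1, 3), (2, 1), (2, 2), (2, 3)}"
  unfolding UNIV_Times_UNIV[symmetric] UNIV_2 UNIV_3 by auto

lemma orientation_point14:
  "orientation_point (t :: real ^ (1 \<times> 4)) $ Inl 1 =
     (1 - t $ (1, 1)) + (1 - t $ (1, 2)) + (1 - t $ (1, 3)) + (1 - t $ (1, 4))"
  "orientation_point t $ Inr 1 = t $ (1, 1)" "orientation_point t $ Inr 2 = t $ (1, 2)"
  "orientation_point t $ Inr 3 = t $ (1, 3)" "orientation_point t $ Inr 4 = t $ (1, 4)"
  by (simp_all only: orientation_point_def vec_lambda_beta sum.case sum_1 sum_4)

lemma orientation_point23:
  "orientation_point (t :: real ^ (2 \<times> 3)) $ Inl 1 = (1 - t $ (1, 1)) + (1 - t $ (1, 2)) + (1 - t $ (1, 3))"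
  "orientation_point t $ Inl 2 = (1 - t $ (2, 1)) + (1 - t $ (2, 2)) + (1 - t $ (2, 3))"
  "orientation_point t $ Inr 1 = t $ (1, 1) + t $ (2, 1)" "orientation_point t $ Inr 2 = t $ (1, 2) + t $ (2, 2)"
  "orientation_point t $ Inr 3 = t $ (1, 3) + t $ (2, 3)"
  by (simp_all only: orientation_point_def vec_lambda_beta sum.case sum_2 sum_3)

lemma integral_vector:
  assumes "\<forall>k. integral_at t k"
  obtains c where "\<And>k. c k \<in> {0, 1}" "\<And>k. t $ k = real_of_int (c k)"
proof
  show "(if t $ k = 0 then 0 else 1) \<in> {0, 1 :: int}" for k by simp
  show "t $ k = real_of_int (if t $ k = 0 then 0 else 1)" for k
    using assms by (auto simp: integral_at_def)
qed

section \<open>Hull and inequality descriptions of the two polytopes\<close>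

lemma P14_subset_hull: "P14 \<subseteq> convex hull (coords14.point ` set V14)"
proof -
  \<comment> \<open>For 0-1 entries, product 1 singles out the all-ones vector, the vertex that the
    cut removes.\<close>
  have check: "list_all (\<lambda>(a, b, c, d). a * b * c * d = 1 \<or> (a, b, c, d) \<in> set V14)
      (List.product [0, 1] (List.product [0, 1] (List.product [0, 1] [0, 1])))"
    by code_simp
  have "orientation_point s \<in> coords14.point ` set V14"
    if s: "\<forall>k. integral_at s k" "\<exists>k. s $ k = 0" for s :: "real ^ (1 \<times> 4)"
  proof -
    obtain c where c: "\<And>k. c k \<in> {0, 1}" "\<And>k. s $ k = real_of_int (c k)"
      using integral_vector[OF s(1)] by blast
    let ?v = "(c (1, 1), c (1, 2), c (1, 3), c (1, 4))"
    obtain k where "c k = 0" using s(2) c(2) by auto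
    moreover have "k \<in> {(1, 1), (1, 2), (1, 3), (1, 4)}" by (metis UNIV_I pairs14)
    ultimately have "c (1, 1) * c (1, 2) * c (1, 3) * c (1, 4) \<noteq> 1" by auto
    moreover have "?v \<in> set (List.product [0, 1] (List.product [0, 1] (List.product [0, 1] [0, 1])))"
      unfolding set_product list.set by (intro SigmaI c(1))
    ultimately have "?v \<in> set V14" using check unfolding list_all_iff by auto
    moreover have "orientation_point s = coords14.point ?v"
      unfolding vec_eq_iff coords14.all_coords coords14.point_nth orientation_point14 c(2) by simp
    ultimately show ?thesis by blast
  qed
  then have "orientation_point ` {s :: real ^ (1 \<times> 4). (\<forall>k. integral_at s k) \<and> (\<exists>k. s $ k = 0)}
      \<subseteq> coords14.point ` set V14" by blast
  from hull_mono[OF this] show ?thesis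
    unfolding P14_def using cut_zonotope_subset_hull by blast
qed

lemma P23_subset_hull: "P23 \<subseteq> convex hull (coords23.point ` set (V23 @ C23))"
proof -
  have check: "list_all (\<lambda>(a, b, c, d, e, f). a * b * c * d * e * f = 1 \<or>
        (3 - a - b - c, a + d, b + e, c + f) \<in> set (V23 @ C23))
      (List.product [0, 1] (List.product [0, 1] (List.product [0, 1] (List.product [0, 1] (List.product [0, 1] [0, 1])))))"
    by code_simp
  have "orientation_point s \<in> coords23.point ` set (V23 @ C23)"
    if s: "\<forall>k. integral_at s k" "\<exists>k. s $ k = 0" for s :: "real ^ (2 \<times> 3)"
  proof -
    obtain c where c: "\<And>k. c k \<in> {0, 1}" "\<And>k. s $ k = real_of_int (c k)"
      using integral_vector[OF s(1)] by blast
    let ?v = "(3 - c (1, 1) - c (1, 2) - c (1, 3), c (1, 1) + c (2, 1), c (1, 2) + c (2, 2), c (1, 3) + c (2, 3))"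
    obtain k where "c k = 0" using s(2) c(2) by auto
    moreover have "k \<in> {(1, 1), (1, 2), (1, 3), (2, 1), (2, 2), (2, 3)}" by (metis UNIV_I pairs23)
    ultimately have "c (1, 1) * c (1, 2) * c (1, 3) * c (2, 1) * c (2, 2) * c (2, 3) \<noteq> 1" by auto
    moreover have "(c (1, 1), c (1, 2), c (1, 3), c (2, 1), c (2, 2), c (2, 3)) \<in>
      set (List.product [0, 1] (List.product [0, 1] (List.product [0, 1] (List.product [0, 1] (List.product [0, 1] [0, 1])))))"
      unfolding set_product list.set by (intro SigmaI c(1))
    ultimately have "?v \<in> set (V23 @ C23)" using check unfolding list_all_iff by fast
    moreover have "orientation_point s = coords23.point ?v"
      unfolding vec_eq_iff coords23.all_coords coords23.point_nth orientation_point23 c(2) by simp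
    ultimately show ?thesis by blast
  qed
  then have "orientation_point ` {s :: real ^ (2 \<times> 3). (\<forall>k. integral_at s k) \<and> (\<exists>k. s $ k = 0)}
      \<subseteq> coords23.point ` set (V23 @ C23)" by blast
  from hull_mono[OF this] show ?thesis
    unfolding P23_def using cut_zonotope_subset_hull by blast
qed

lemma P14_eq: "P14 = {x \<in> coords14.hyperplane. \<forall>h\<in>set H14. 0 \<le> coords14.lin h x}"
proof (intro equalityI subsetI)
  fix x assume "x \<in> P14"
  then obtain t :: "real ^ (1 \<times> 4)" where t: "\<And>k. 0 \<le> t $ k \<and> t $ k \<le> 1"
    "(\<Sum>k\<in>UNIV. t $ k) \<le> real CARD(1 \<times> 4) - 1" "x = orientation_point t"
    unfolding P14_def mem_cut_zonotope_iff by blast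
  have "t $ (1, 1) + t $ (1, 2) + t $ (1, 3) + t $ (1, 4) \<le> 3"
    using t(2) by (simp add: pairs14)
  then show "x \<in> {x \<in> coords14.hyperplane. \<forall>h\<in>set H14. 0 \<le> coords14.lin h x}"
    using t(1)[of "(1, 1)"] t(1)[of "(1, 2)"] t(1)[of "(1, 3)"] t(1)[of "(1, 4)"]
    by (simp add: t(3) H14_def coords14.lin_def coords14.hyperplane_def coords14.sum_coords orientation_point14)
next
  fix x assume "x \<in> {x \<in> coords14.hyperplane. \<forall>h\<in>set H14. 0 \<le> coords14.lin h x}"
  then have x: "x $ Inl 1 + x $ Inr 1 + x $ Inr 2 + x $ Inr 3 + x $ Inr 4 = 4"
    "0 \<le> x $ Inr 1" "0 \<le> x $ Inr 2" "0 \<le> x $ Inr 3" "0 \<le> x $ Inr 4"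
    "x $ Inr 1 \<le> 1" "x $ Inr 2 \<le> 1" "x $ Inr 3 \<le> 1" "x $ Inr 4 \<le> 1"
    "x $ Inr 1 + x $ Inr 2 + x $ Inr 3 + x $ Inr 4 \<le> 3"
    by (simp_all add: H14_def coords14.lin_def coords14.hyperplane_def coords14.sum_coords)
  \<comment> \<open>With a single \<open>a\<close>-vertex, the \<open>b\<close>-coordinates are
    themselves the positions on the segments.\<close>
  define t :: "real ^ (1 \<times> 4)" where "t = (\<chi> k. x $ Inr (snd k))"
  have "\<forall>k. 0 \<le> t $ k \<and> t $ k \<le> 1"
    unfolding t_def using x exhaust_4 by (auto simp: forall_4)
  moreover have "(\<Sum>k\<in>UNIV. t $ k) \<le> real CARD(1 \<times> 4) - 1"
    using x by (simp add: pairs14 t_def)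
  moreover have "x = orientation_point t"
    unfolding vec_eq_iff coords14.all_coords orientation_point14 t_def using x by simp
  ultimately show "x \<in> P14" unfolding P14_def mem_cut_zonotope_iff by blast
qed

text \<open>A greedy choice: each of the first two summands is as large as its upper bound and the
  lower bounds still to be met allow, and the last takes the remainder.\<close>

lemma interpolate_sum:
  fixes l1 l2 l3 u1 u2 u3 r :: real
  assumes "l1 \<le> u1" "l2 \<le> u2" "l3 \<le> u3" "l1 + l2 + l3 \<le> r" "r \<le> u1 + u2 + u3"
  obtains s1 s2 s3 where "l1 \<le> s1" "s1 \<le> u1" "l2 \<le> s2" "s2 \<le> u2" "l3 \<le> s3" "s3 \<le> u3" "s1 + s2 + s3 = r"
proof -
  define s1 where "s1 = min u1 (r - l2 - l3)"
  define s2 where "s2 = min u2 (r - s1 - l3)"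
  show thesis
    by (rule that[of s1 s2 "r - s1 - s2"]) (use assms in \<open>auto simp: s1_def s2_def min_def split: if_splits\<close>)
qed

text \<open>To lift a point of the hyperplane to a matrix, note that the column sums confine the entries of
  the first row to intervals; the remaining inequalities say that the first row sum lies between the
  sums of their lower and of their upper ends.\<close>

lemma P23_eq: "P23 = {x \<in> coords23.hyperplane. \<forall>h\<in>set H23. 0 \<le> coords23.lin h x}"
proof (intro equalityI subsetI)
  fix x assume "x \<in> P23"
  then obtain t :: "real ^ (2 \<times> 3)" where t: "\<And>k. 0 \<le> t $ k \<and> t $ k \<le> 1"
    "(\<Sum>k\<in>UNIV. t $ k) \<le> real CARD(2 \<times> 3) - 1" "x = orientation_point t"
    unfolding P23_def mem_cut_zonotope_iff by blast
  have "t $ (1, 1) + t $ (1, 2) + t $ (1, 3) + t $ (2, 1) + t $ (2, 2) + t $ (2, 3) \<le> 5"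
    using t(2) by (simp add: pairs23)
  then show "x \<in> {x \<in> coords23.hyperplane. \<forall>h\<in>set H23. 0 \<le> coords23.lin h x}"
    using t(1)[of "(1, 1)"] t(1)[of "(1, 2)"] t(1)[of "(1, 3)"] t(1)[of "(2, 1)"] t(1)[of "(2, 2)"] t(1)[of "(2, 3)"]
    by (simp add: t(3) H23_def coords23.lin_def coords23.hyperplane_def coords23.sum_coords orientation_point23)
next
  fix x assume x: "x \<in> {x \<in> coords23.hyperplane. \<forall>h\<in>set H23. 0 \<le> coords23.lin h x}"
  define r c1 c2 c3 where "r = 3 - x $ Inl 1" and "c1 = x $ Inr 1" and "c2 = x $ Inr 2" and "c3 = x $ Inr 3"
  have a2: "x $ Inl 2 = 3 + r - c1 - c2 - c3" and
    c: "0 \<le> c1" "0 \<le> c2" "0 \<le> c3" "c1 \<le> 2" "c2 \<le> 2" "c3 \<le> 2" "c1 + c2 + c3 \<le> 5" and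
    lower: "0 \<le> r" "c1 - 1 \<le> r" "c2 - 1 \<le> r" "c3 - 1 \<le> r" "c1 + c2 - 2 \<le> r" "c1 + c3 - 2 \<le> r" "c2 + c3 - 2 \<le> r"
      "c1 + c2 + c3 - 3 \<le> r" and
    upper: "r \<le> 3" "r \<le> c1 + 2" "r \<le> c2 + 2" "r \<le> c3 + 2" "r \<le> c1 + c2 + 1" "r \<le> c1 + c3 + 1" "r \<le> c2 + c3 + 1"
      "r \<le> c1 + c2 + c3"
    using x unfolding r_def c1_def c2_def c3_def
    by (simp_all add: H23_def coords23.lin_def coords23.hyperplane_def coords23.sum_coords)
  obtain s1 s2 s3 where s: "max 0 (c1 - 1) \<le> s1" "s1 \<le> min 1 c1" "max 0 (c2 - 1) \<le> s2" "s2 \<le> min 1 c2"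
    "max 0 (c3 - 1) \<le> s3" "s3 \<le> min 1 c3" "s1 + s2 + s3 = r"
  proof (rule interpolate_sum[of "max 0 (c1 - 1)" "min 1 c1" "max 0 (c2 - 1)" "min 1 c2" "max 0 (c3 - 1)" "min 1 c3" r])
    \<comment> \<open>Resolving the three maxima gives eight cases, one for each set
      \<open>J\<close> of columns, and these are the eight bounds in \<open>lower\<close>; the
      minima match \<open>upper\<close> in the same way.\<close>
    show "max 0 (c1 - 1) + max 0 (c2 - 1) + max 0 (c3 - 1) \<le> r"
      using lower by (simp add: max_def)
    show "r \<le> min 1 c1 + min 1 c2 + min 1 c3" using upper by (simp add: min_def)
  qed (use c in auto)
  define t :: "real ^ (2 \<times> 3)" where "t = (\<chi> k. if k = (1, 1) then s1 else if k = (1, 2) then s2 else if k = (1, 3) then s3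
     else if k = (2, 1) then c1 - s1 else if k = (2, 2) then c2 - s2 else c3 - s3)"
  have t: "t $ (1, 1) = s1" "t $ (1, 2) = s2" "t $ (1, 3) = s3"
    "t $ (2, 1) = c1 - s1" "t $ (2, 2) = c2 - s2" "t $ (2, 3) = c3 - s3"
    by (simp_all add: t_def)
  have "\<forall>k\<in>UNIV. 0 \<le> t $ k \<and> t $ k \<le> 1"
    unfolding pairs23 using s t by simp
  moreover have "(\<Sum>k\<in>UNIV. t $ k) \<le> real CARD(2 \<times> 3) - 1"
    using c t by (simp add: pairs23)
  moreover have "x = orientation_point t"
    unfolding vec_eq_iff coords23.all_coords orientation_point23 t using a2 s(7)
    by (simp add: r_def c1_def c2_def c3_def)
  ultimately show "x \<in> P23" unfolding P23_def mem_cut_zonotope_iff by blast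
qed

interpretation model14: incidence_model P14 coords14.hyperplane H14 coords14.lin coords14.point V14 vanishes
proof (rule coords14.incidence_modelI[OF P14_eq P14_subset_hull])
  show "list_all (\<lambda>w. list_all (\<lambda>h. 0 \<le> slack h w) H14) V14" by code_simp
  show "distinct V14" by code_simp
  show "extremal vanishes H14 (map (row vanishes H14) V14) V14 = V14" by code_simp
  show "facets_ok vanishes H14 V14" by code_simp
qed

interpretation model23: incidence_model P23 coords23.hyperplane H23 coords23.lin coords23.point V23 vanishes
proof (rule coords23.incidence_modelI[OF P23_eq P23_subset_hull])
  show "list_all (\<lambda>w. list_all (\<lambda>h. 0 \<le> slack h w) H23) (V23 @ C23)" by code_simp
  show "distinct (V23 @ C23)" by code_simp
  show "extremal vanishes H23 (map (row vanishes H23) (V23 @ C23)) (V23 @ C23) = V23" by code_simp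
  show "facets_ok vanishes H23 V23" by code_simp
qed

section \<open>Face numbers, indecomposability and the counterexamples\<close>

lemma P14_f_vector: "f_vector4 P14 = (15, 34, 28, 9)"
proof -
  have "edge_count (map (row vanishes H14) V14) (map (row vanishes H14) V14) = 34" by code_simp
  moreover have "length (ridges vanishes H14 V14) = 28" by code_simp
  moreover have "length V14 = 15" "length H14 = 9" by code_simp+
  ultimately show ?thesis
    by (simp add: f_vector4_def model14.num_vertices model14.num_edges model14.num_ridges model14.num_facets)
qed

lemma P23_f_vector: "f_vector4 P23 = (45, 111, 89, 23)"
proof -
  have "edge_count (map (row vanishes H23) V23) (map (row vanishes H23) V23) = 111" by code_simp
  moreover have "length (ridges vanishes H23 V23) = 89" by code_simp
  moreover have "length V23 = 45" "length H23 = 23" by code_simp+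
  ultimately show ?thesis
    by (simp add: f_vector4_def model23.num_vertices model23.num_edges model23.num_ridges model23.num_facets)
qed

lemma P14_indecomposable: "indecomposable P14"
  by (rule model14.indecomposable[of E14]) code_simp

lemma P23_indecomposable: "indecomposable P23"
  by (rule model23.indecomposable[of E23]) code_simp

theorem mainTheorem10:
  shows "(indecomposable P14 \<and> aff_dim P14 = 4 \<and> f_vector4 P14 = (15, 34, 28, 9)) \<and>
         (indecomposable P23 \<and> aff_dim P23 = 4 \<and> f_vector4 P23 = (45, 111, 89, 23)) \<and>
         smilansky_inequality 4 P14 \<and>
         smilansky_inequality 4 P23 \<and>
         \<not> smilansky_conjecture TYPE(real ^ (1 + 4)) \<and>
         \<not> smilansky_conjecture TYPE(real ^ (2 + 3))"
proof -
  have f14: "num_vertices P14 = 15" "num_facets P14 = 9"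
    using P14_f_vector by (simp_all add: f_vector4_def)
  have f23: "num_vertices P23 = 45" "num_facets P23 = 23"
    using P23_f_vector by (simp_all add: f_vector4_def)
  \<comment> \<open>With 9 facets the bound is \<open>1 + 6 + 6 = 13\<close>, below 15.\<close>
  have s14: "smilansky_inequality 4 P14"
    by (simp add: smilansky_inequality_def f14 binomial_symmetric[of 5 6])
  \<comment> \<open>With 23 facets the bound is \<open>1 + 20 + 20 = 41\<close>, below 45.\<close>
  have s23: "smilansky_inequality 4 P23"
    by (simp add: smilansky_inequality_def f23 binomial_symmetric[of 19 20])
  have dim: "aff_dim P14 = 4" "aff_dim P23 = 4"
    using model14.dim_P_facets model23.dim_P_facets by blast+
  have "\<not> smilansky_conjecture TYPE(real ^ (1 + 4))"
    unfolding smilansky_conjecture_def decomposable_def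
    using s14 dim(1) P14_indecomposable model14.polytope_P by (metis of_nat_numeral)
  moreover have "\<not> smilansky_conjecture TYPE(real ^ (2 + 3))"
    unfolding smilansky_conjecture_def decomposable_def
    using s23 dim(2) P23_indecomposable model23.polytope_P by (metis of_nat_numeral)
  ultimately show ?thesis
    using s14 s23 dim P14_indecomposable P23_indecomposable P14_f_vector P23_f_vector by blast
qed

end
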